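(* Let $\lambda\in\mathbb{R}^d$ and let $\xi(t)$, $t\in\mathbb{R}$, be an $\mathbb{R}^d$-valued stochastic process with $\mathbf{E}e^{\langle\lambda,\xi(t)\rangle}<\infty$ for all $t\in\mathbb{R}$. The particle system generated by $\mathfrak{e}_\lambda$ and $\xi$ is stationary if and only if $$\varphi_{t_1,\dots,t_n}(u_1-\imath\lambda,u_2,\dots,u_n)=\varphi_{t_1+s,\dots,t_n+s}(u_1-\imath\lambda,u_2,\dots,u_n)$$ for all $n\ge1$, $s,t_1,\dots,t_n\in\mathbb{R}$ and $u_1,\dots,u_n\in\mathbb{R}^d$ satisfying $\sum_{i=1}^n u_i=0$.
   Context: $\mathfrak{e}_\lambda$ is the measure on $\mathbb{R}^d$ with Lebesgue density $e^{-\langle\lambda,x\rangle}$. $\imath$ is the imaginary unit and $$\varphi_{t_1,\dots,t_n}(u_1-\imath\lambda,u_2,\dots,u_n)=\mathbf{E}\exp\{\imath(\langle u_1-\imath\lambda,\xi(t_1)\rangle+\langle u_2,\xi(t_2)\rangle+\dots+\langle u_n,\xi(t_n)\rangle)\},$$ with $\langle\cdot,\cdot\rangle$ extended bilinearly, i.e. the expectation of $e^{\langle\lambda,\xi(t_1)\rangle}\exp\{\imath\sum_i\langle u_i,\xi(t_i)\rangle\}$. The particle system generated by a measure $\Lambda$ on $\mathbb{R}^d$ and $\xi$ is $N(t)=\{x_i+\xi_i(t):\, i\ge1\}$, $t\in\mathbb{R}$, where $\{x_i\}$ is a Poisson point process on $\mathbb{R}^d$ with intensity measure $\Lambda$, independent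 of i.i.d. copies $\xi_1,\xi_2,\dots$ of $\xi$. It is stationary if, for all $n\ge1$ and $s,t_1,\dots,t_n\in\mathbb{R}$, the point processes $N(t_1,\dots,t_n)=\{(x_i+\xi_i(t_1),\dots,x_i+\xi_i(t_n)):\, i\ge1\}$ and $N(t_1+s,\dots,t_n+s)$ in $\mathbb{R}^{dn}$ have the same distribution. *)

theory Defs
  imports "HOL-Probability.Probability"
begin

text \<open>
  The space of all measures on \<open>E\<close> with the \<open>\<sigma>\<close>-algebra generated by the evaluations
  \<open>\<mu> \<mapsto> \<mu> B\<close>. It is built like the library's \<^const>\<open>subprob_algebra\<close>, but without the bound on the
  total mass. A point process on \<open>E\<close> is a random element of it, and its distribution is
  the push-forward of the underlying probability measure to this space.
\<close>

definition measure_algebra :: "'b measure \<Rightarrow> 'b measure measure" where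
  "measure_algebra E =
     (SUP B\<in>sets E. vimage_algebra {\<mu>. sets \<mu> = sets E} (\<lambda>\<mu>. emeasure \<mu> B) borel)"

lemma space_measure_algebra: "space (measure_algebra E) = {\<mu>. sets \<mu> = sets E}"
  by (auto simp: measure_algebra_def space_Sup_eq_UN)

text \<open>
  The configuration \<open>{p i : i}\<close>, with multiplicities, as the counting measure \<open>\<Sum>i. \<delta>_(p i)\<close> on \<open>E\<close>:
  \<open>point_config E p B\<close> is the number of indices \<open>i\<close> with \<open>p i \<in> B\<close>.
\<close>

definition point_config :: "'b measure \<Rightarrow> (nat \<Rightarrow> 'b) \<Rightarrow> 'b measure" where
  "point_config E p = distr (count_space UNIV) E p"

lemma emeasure_point_config:
  assumes "\<And>i. p i \<in> space E" "B \<in> sets E"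
  shows "emeasure (point_config E p) B = emeasure (count_space UNIV) {i. p i \<in> B}"
proof -
  have "p \<in> measurable (count_space UNIV) E"
    using assms(1) by simp
  then show ?thesis
    using assms(2) by (simp add: point_config_def emeasure_distr vimage_def)
qed

lemma measurable_point_config:
  assumes p: "\<And>i. p i \<in> measurable M E"
  shows "(\<lambda>\<omega>. point_config E (\<lambda>i. p i \<omega>)) \<in> measurable M (measure_algebra E)"
  unfolding measure_algebra_def
proof (intro measurable_Sup2 measurable_vimage_algebra2)
  fix B
  have *: "(\<lambda>\<omega>. point_config E (\<lambda>i. p i \<omega>)) \<in> space M \<rightarrow> {\<mu>. sets \<mu> = sets E}"
    by (simp add: point_config_def)
  assume "B \<in> (\<lambda>B. vimage_algebra {\<mu>. sets \<mu> = sets E} (\<lambda>\<mu>. emeasure \<mu> B) borel) ` sets E"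
  then obtain A where A: "A \<in> sets E"
    and B: "B = vimage_algebra {\<mu>. sets \<mu> = sets E} (\<lambda>\<mu>. emeasure \<mu> A) borel"
    by auto
  have "(\<lambda>\<omega>. \<Sum>i. indicator A (p i \<omega>) :: ennreal) \<in> borel_measurable M"
    using p A by measurable
  also have "?this \<longleftrightarrow> (\<lambda>\<omega>. emeasure (point_config E (\<lambda>i. p i \<omega>)) A) \<in> borel_measurable M"
  proof (rule measurable_cong)
    fix \<omega> assume "\<omega> \<in> space M"
    then have "\<And>i. p i \<omega> \<in> space E"
      using p by (auto dest: measurable_space)
    then have "emeasure (point_config E (\<lambda>i. p i \<omega>)) A = emeasure (count_space UNIV) {i. p i \<omega> \<in> A}"
      using A by (rule emeasure_point_config)
    also have "\<dots> = (\<integral>\<^sup>+i. indicator {i. p i \<omega> \<in> A} i \<partial>count_space UNIV)"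
      by simp
    also have "\<dots> = (\<Sum>i. indicator A (p i \<omega>))"
      by (simp add: nn_integral_count_space_nat indicator_def)
    finally show "(\<Sum>i. indicator A (p i \<omega>)) = emeasure (point_config E (\<lambda>i. p i \<omega>)) A"
      by simp
  qed
  finally show "(\<lambda>\<omega>. point_config E (\<lambda>i. p i \<omega>)) \<in> measurable M B"
    unfolding B using * by (intro measurable_vimage_algebra2) auto
qed (auto simp: point_config_def)

definition (in prob_space) poisson_point_process :: "'b measure \<Rightarrow> ('a \<Rightarrow> 'b measure) \<Rightarrow> bool" where
  "poisson_point_process \<Lambda> N \<longleftrightarrow>
     N \<in> measurable M (measure_algebra \<Lambda>) \<and>
     (\<forall>B\<in>sets \<Lambda>. emeasure \<Lambda> B < \<infinity> \<longrightarrow>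
        (\<forall>k::nat. prob {\<omega>\<in>space M. emeasure (N \<omega>) B = of_nat k}
           = measure \<Lambda> B ^ k / fact k * exp (- measure \<Lambda> B))) \<and>
     (\<forall>B\<in>sets \<Lambda>. emeasure \<Lambda> B = \<infinity> \<longrightarrow> (AE \<omega> in M. emeasure (N \<omega>) B = \<infinity>)) \<and>
     (\<forall>(I :: nat set) B. finite I \<longrightarrow> B ` I \<subseteq> sets \<Lambda> \<longrightarrow> disjoint_family_on B I \<longrightarrow>
        indep_vars (\<lambda>_. borel) (\<lambda>i \<omega>. emeasure (N \<omega>) (B i)) I)"

text \<open>
  Independence of two random elements. It extends \<^const>\<open>prob_space.indep_var\<close>, which forces both
  to have the same value type.
\<close>

definition (in prob_space) indep_elements ::
    "'b measure \<Rightarrow> ('a \<Rightarrow> 'b) \<Rightarrow> 'c measure \<Rightarrow> ('a \<Rightarrow> 'c) \<Rightarrow> bool" where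
  "indep_elements S X T Y \<longleftrightarrow>
     X \<in> measurable M S \<and> Y \<in> measurable M T \<and>
     indep_set {X -` A \<inter> space M |A. A \<in> sets S} {Y -` B \<inter> space M |B. B \<in> sets T}"

text \<open>
  A realisation \<open>(x\<^sub>i), (\<Xi>\<^sub>i)\<close> on the probability space \<open>M\<close> of the particle system generated by
  \<open>\<Lambda>\<close> and the process \<open>\<xi>\<close>, which lives on its own probability space \<open>P\<close>. Processes are random
  elements of the product space indexed by \<open>\<real>\<close>, so their laws are given by the finite-dimensional
  distributions. The enumeration \<open>(x\<^sub>i)\<close> of the Poisson process, and not merely the
  configuration, is independent of the motions. Enumerating by all of \<^typ>\<open>nat\<close> amounts to \<open>\<Lambda>\<close> having infinite
  total mass, as \<open>exp_measure \<lambda>\<close> below always does.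
\<close>

locale particle_system = prob_space M
  for M :: "'w measure" +
  fixes \<Lambda> :: "(real ^ 'd) measure"
    and P :: "'p measure"
    and \<xi> :: "real \<Rightarrow> 'p \<Rightarrow> real ^ 'd"
    and x :: "nat \<Rightarrow> 'w \<Rightarrow> real ^ 'd"
    and \<Xi> :: "nat \<Rightarrow> real \<Rightarrow> 'w \<Rightarrow> real ^ 'd"
  assumes sets_intensity: "sets \<Lambda> = sets borel"
    and points: "poisson_point_process \<Lambda> (\<lambda>\<omega>. point_config borel (\<lambda>i. x i \<omega>))"
    and copies_indep:
      "indep_vars (\<lambda>_. \<Pi>\<^sub>M t\<in>UNIV. borel) (\<lambda>i \<omega> t. \<Xi> i t \<omega>) UNIV"
    and copies_distr:
      "\<And>i. distr M (\<Pi>\<^sub>M t\<in>UNIV. borel) (\<lambda>\<omega> t. \<Xi> i t \<omega>) =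
           distr P (\<Pi>\<^sub>M t\<in>UNIV. borel) (\<lambda>\<omega> t. \<xi> t \<omega>)"
    and points_copies_indep:
      "indep_elements (\<Pi>\<^sub>M i\<in>UNIV. borel) (\<lambda>\<omega> i. x i \<omega>)
         (\<Pi>\<^sub>M i\<in>UNIV. \<Pi>\<^sub>M t\<in>UNIV. borel) (\<lambda>\<omega> i t. \<Xi> i t \<omega>)"

text \<open>
  Points of \<open>\<real>\<^sup>d\<^sup>n\<close> are families in \<open>\<real>\<^sup>d\<close> indexed by \<open>{1..n}\<close>, and only the values of \<open>t\<close> on
  \<open>{1..n}\<close> matter.
\<close>

abbreviation tuple_space :: "nat \<Rightarrow> (nat \<Rightarrow> real ^ 'd) measure" where
  "tuple_space n \<equiv> (\<Pi>\<^sub>M j\<in>{1..n}. borel)"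

definition particles ::
    "(nat \<Rightarrow> 'w \<Rightarrow> real ^ 'd) \<Rightarrow> (nat \<Rightarrow> real \<Rightarrow> 'w \<Rightarrow> real ^ 'd) \<Rightarrow>
     nat \<Rightarrow> (nat \<Rightarrow> real) \<Rightarrow> 'w \<Rightarrow> (nat \<Rightarrow> real ^ 'd) measure" where
  "particles x \<Xi> n t \<omega> =
     point_config (tuple_space n) (\<lambda>i. \<lambda>j\<in>{1..n}. x i \<omega> + \<Xi> i (t j) \<omega>)"

definition stationary_particles ::
    "'w measure \<Rightarrow> (nat \<Rightarrow> 'w \<Rightarrow> real ^ 'd) \<Rightarrow> (nat \<Rightarrow> real \<Rightarrow> 'w \<Rightarrow> real ^ 'd) \<Rightarrow> bool" where
  "stationary_particles M x \<Xi> \<longleftrightarrow>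
     (\<forall>n\<ge>1. \<forall>s t.
        distr M (measure_algebra (tuple_space n)) (particles x \<Xi> n t) =
        distr M (measure_algebra (tuple_space n)) (particles x \<Xi> n (\<lambda>j. t j + s)))"

definition exp_measure :: "real ^ 'd \<Rightarrow> (real ^ 'd) measure" where
  "exp_measure l = density lborel (\<lambda>y. ennreal (exp (- (l \<bullet> y))))"

definition cvec :: "real ^ 'd \<Rightarrow> complex ^ 'd" where
  "cvec v = (\<chi> j. complex_of_real (v $ j))"

text \<open>Bilinear, not sesquilinear: no conjugation in either argument.\<close>

definition cdot :: "complex ^ 'd \<Rightarrow> complex ^ 'd \<Rightarrow> complex" where
  "cdot z w = (\<Sum>j\<in>UNIV. z $ j * w $ j)"

definition char_fun ::
    "'p measure \<Rightarrow> (real \<Rightarrow> 'p \<Rightarrow> real ^ 'd) \<Rightarrow> nat \<Rightarrow> (nat \<Rightarrow> real) \<Rightarrow> (nat \<Rightarrow> complex ^ 'd) \<Rightarrow> complex" where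
  "char_fun P \<xi> n t z =
     (\<integral>\<omega>. exp (\<i> * (\<Sum>j=1..n. cdot (z j) (cvec (\<xi> (t j) \<omega>)))) \<partial>P)"

text \<open>The argument \<open>(u\<^sub>1 - \<i>\<lambda>, u\<^sub>2, \<dots>, u\<^sub>n)\<close> of the characteristic function.\<close>

definition tilt :: "real ^ 'd \<Rightarrow> (nat \<Rightarrow> real ^ 'd) \<Rightarrow> nat \<Rightarrow> complex ^ 'd" where
  "tilt l u j = (if j = 1 then cvec (u j) - \<i> *s cvec l else cvec (u j))"

lemma cdot_cvec: "cdot (cvec v) (cvec w) = complex_of_real (v \<bullet> w)"
  by (simp add: cdot_def cvec_def inner_vec_def)

lemma cdot_tilt:
  "cdot (tilt l u j) (cvec v) =
     complex_of_real (u j \<bullet> v) - (if j = 1 then \<i> * complex_of_real (l \<bullet> v) else 0)"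
  by (simp add: tilt_def cdot_def cvec_def inner_vec_def left_diff_distrib sum_subtractf
      sum_distrib_left mult.assoc)

lemma char_fun_tilt:
  assumes "n \<ge> 1"
  shows "char_fun P \<xi> n t (tilt l u) =
    (\<integral>\<omega>. complex_of_real (exp (l \<bullet> \<xi> (t 1) \<omega>)) *
       exp (\<i> * complex_of_real (\<Sum>j=1..n. u j \<bullet> \<xi> (t j) \<omega>)) \<partial>P)"
proof -
  have *: "(\<Sum>j=1..n. cdot (tilt l u j) (cvec (\<xi> (t j) \<omega>))) =
     complex_of_real (\<Sum>j=1..n. u j \<bullet> \<xi> (t j) \<omega>) - \<i> * complex_of_real (l \<bullet> \<xi> (t 1) \<omega>)" for \<omega>
    using assms by (simp add: cdot_tilt sum_subtractf sum.delta)
  show ?thesis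
    unfolding char_fun_def *
    by (intro Bochner_Integration.integral_cong refl)
      (simp only: exp_of_real[symmetric] exp_add[symmetric], simp add: algebra_simps)
qed

end

theory Submission
  imports Defs
begin

text \<open>
  Let \<open>\<Lambda>\<^sub>t\<close> be the intensity of the particle positions at the times \<open>t\<^sub>1, \<dots>, t\<^sub>n\<close>, that is, the image of
  \<open>\<e>\<^sub>\<lambda> \<otimes> \<P>\<close> under \<open>(y, \<omega>) \<mapsto> (y + \<xi>(t\<^sub>1), \<dots>, y + \<xi>(t\<^sub>n))\<close>. Independently moved points of a Poisson process
  form a Poisson process again, so the law of \<open>N(t\<^sub>1, \<dots>, t\<^sub>n)\<close> and the measure \<open>\<Lambda>\<^sub>t\<close> determine each other.
  Stationarity thus means that \<open>\<Lambda>\<^sub>t\<close> is unchanged when all times are shifted, and it remains to read off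
  this property from the characteristic functions.

  The first half (\<open>particles_law_eq_iff_intensity_eq\<close>) goes through the Laplace functional: for every
  measurable \<open>f \<ge> 0\<close>,
  \<open>E exp (- \<integral> f dN) = exp (- \<integral> (1 - exp (- f)) d\<Lambda>\<^sub>t)\<close>. For the unmoved Poisson process this is shown on
  simple functions, where it is independence and the Poisson generating function, and then by monotone
  limits (\<open>poisson_laplace_functional\<close>). Integrating out the motions first, given the starting points,
  replaces \<open>exp (- f)\<close> by its average over one motion and transfers the formula to the moved particles
  (\<open>particles_laplace_functional\<close>). Taking \<open>f\<close> to be the indicator of \<open>B\<close> recovers \<open>\<Lambda>\<^sub>t B\<close>; conversely, the
  Laplace functional contains all joint moments of the bounded variables \<open>exp (- N B)\<close>, and these
  fix the law of the point process (\<open>point_process_law_eqI\<close>).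

  For the second half (\<open>particle_intensity_eq_iff_char_fun_eq\<close>), the translation \<open>y \<mapsto> y - \<xi>(t\<^sub>1)\<close> turns the
  density \<open>exp (- \<langle>\<lambda>, y\<rangle>)\<close> into \<open>exp (- \<langle>\<lambda>, y\<rangle>) exp \<langle>\<lambda>, \<xi>(t\<^sub>1)\<rangle>\<close>. Hence \<open>\<Lambda>\<^sub>t\<close> is also the image of
  \<open>\<e>\<^sub>\<lambda> \<otimes> \<Q>\<close>, where \<open>\<Q>\<close> has density \<open>exp \<langle>\<lambda>, \<xi>(t\<^sub>1)\<rangle>\<close> with respect to \<open>\<P>\<close>, under
  \<open>(y, \<omega>) \<mapsto> (y + \<xi>(t\<^sub>j) - \<xi>(t\<^sub>1))\<^sub>j\<close>. So \<open>\<Lambda>\<^sub>t\<close> depends only on the law of the increments \<open>\<xi>(t\<^sub>j) - \<xi>(t\<^sub>1)\<close> under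
  the finite measure \<open>\<Q>\<close>. The Fourier transform of that law consists exactly of the values
  \<open>\<phi>(u\<^sub>1 - \<i>\<lambda>, u\<^sub>2, \<dots>, u\<^sub>n)\<close> with \<open>\<Sum> u\<^sub>i = 0\<close>. In the other direction, a wave \<open>exp (\<i> \<Sum> \<langle>u\<^sub>j, z\<^sub>j\<rangle>)\<close> with
  \<open>\<Sum> u\<^sub>j = 0\<close> does not see the common translation by \<open>y\<close>, so its integral over the tuples with \<open>z\<^sub>1\<close> in a ball is
  that value of \<open>\<phi>\<close> times the mass of the ball.

  Both halves need uniqueness in several variables, once for Fourier transforms and once for moments. They
  share the notion of a determining class of test functions, which is stable under finite products.
\<close>

section \<open>Test functions that determine complex measures\<close>

text \<open>
  The complex measure with density \<open>h\<close> with respect to \<open>Q\<close> is pushed forward by \<open>f\<close>; if it annihilates all test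
  functions in \<open>T\<close> then it is zero. Complex densities, rather than positive ones, make the notion stable under
  products: a test function of the other variables can be absorbed into \<open>h\<close>.
\<close>

definition determining :: "'q measure \<Rightarrow> 'b measure \<Rightarrow> ('b \<Rightarrow> complex) set \<Rightarrow> bool" where
  "determining Q E T \<longleftrightarrow>
     (\<forall>h f. integrable Q h \<longrightarrow> f \<in> measurable Q E \<longrightarrow>
        (\<forall>\<phi>\<in>T. (\<integral>q. \<phi> (f q) * h q \<partial>Q) = 0) \<longrightarrow>
        (\<forall>A\<in>sets E. (\<integral>q. indicator A (f q) * h q \<partial>Q) = 0))"

lemma determiningI:
  assumes "\<And>h f A. integrable Q h \<Longrightarrow> f \<in> measurable Q E \<Longrightarrow>
      (\<And>\<phi>. \<phi> \<in> T \<Longrightarrow> (\<integral>q. \<phi> (f q) * h q \<partial>Q) = 0) \<Longrightarrow> A \<in> sets E \<Longrightarrow>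
      (\<integral>q. indicator A (f q) * h q \<partial>Q) = 0"
  shows "determining Q E T"
  using assms unfolding determining_def by blast

lemma determiningD:
  assumes "determining Q E T" "integrable Q h" "f \<in> measurable Q E"
    "\<And>\<phi>. \<phi> \<in> T \<Longrightarrow> (\<integral>q. \<phi> (f q) * h q \<partial>Q) = 0" "A \<in> sets E"
  shows "(\<integral>q. indicator A (f q) * h q \<partial>Q) = 0"
  using assms unfolding determining_def by blast

lemma integrable_bounded_mult:
  fixes g h :: "'q \<Rightarrow> complex"
  assumes "integrable Q h" "g \<in> borel_measurable Q" "\<And>q. norm (g q) \<le> 1"
  shows "integrable Q (\<lambda>q. g q * h q)"
proof (rule Bochner_Integration.integrable_bound[OF assms(1)])
  show "(\<lambda>q. g q * h q) \<in> borel_measurable Q" using assms by auto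
  show "AE q in Q. norm (g q * h q) \<le> norm (h q)"
    using assms(3) by (auto simp: norm_mult intro!: mult_left_le_one_le)
qed

text \<open>
  The positive and the negative part of \<open>h\<close> have the same total mass, by \<open>c = 0\<close>. After normalisation, their
  images under \<open>f\<close> are probability measures with the same characteristic function, so Levy's uniqueness
  theorem applies.
\<close>

lemma real_weight_zero_of_fourier_zero:
  fixes h :: "'q \<Rightarrow> real" and f :: "'q \<Rightarrow> real"
  assumes h: "integrable Q h" and f[measurable]: "f \<in> borel_measurable Q"
    and zero: "\<And>c. (\<integral>q. iexp (c * f q) * of_real (h q) \<partial>Q) = 0"
    and A[measurable]: "A \<in> sets borel"
  shows "(\<integral>q. indicator A (f q) * h q \<partial>Q) = 0"
proof -
  define hp where "hp q = max 0 (h q)" for q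
  define hn where "hn q = max 0 (- h q)" for q
  have [measurable]: "h \<in> borel_measurable Q" using h by auto
  have ip: "integrable Q hp" and im: "integrable Q hn"
    using h unfolding hp_def hn_def by (auto intro!: integrable_max)
  have split: "h q = hp q - hn q" for q unfolding hp_def hn_def by auto
  have pos: "0 \<le> hp q" "0 \<le> hn q" for q unfolding hp_def hn_def by auto
  have int_osc: "integrable Q (\<lambda>q. iexp (c * f q) * of_real (g q))" if "integrable Q g" for g c
    using that by (intro integrable_bounded_mult) auto
  have osc: "(\<integral>q. iexp (c * f q) * of_real (hp q) \<partial>Q) = (\<integral>q. iexp (c * f q) * of_real (hn q) \<partial>Q)" for c
    using zero[of c] int_osc[OF ip, of c] int_osc[OF im, of c] by (simp add: split right_diff_distrib)
  have int_A: "integrable Q (\<lambda>q. indicator A (f q) * g q)" if "integrable Q g" for g :: "'q \<Rightarrow> real"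
    using integrable_mult_indicator[OF _ that, of "f -` A \<inter> space Q"]
    by (rule Bochner_Integration.integrable_cong[THEN iffD1, rotated 2]) (auto simp: indicator_def)
  define m where "m = (\<integral>q. hp q \<partial>Q)"
  have m: "m = (\<integral>q. hn q \<partial>Q)" using osc[of 0] unfolding m_def by simp
  have "m \<ge> 0" unfolding m_def using pos by simp
  have "(\<integral>q. indicator A (f q) * hp q \<partial>Q) = (\<integral>q. indicator A (f q) * hn q \<partial>Q)"
  proof (cases "m = 0")
    case True
    have "AE q in Q. hp q = 0" "AE q in Q. hn q = 0"
      using True m integral_nonneg_eq_0_iff_AE[OF ip] integral_nonneg_eq_0_iff_AE[OF im] pos
      unfolding m_def by auto
    then have "AE q in Q. indicator A (f q) * hp q = 0" "AE q in Q. indicator A (f q) * hn q = 0"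
      by (simp_all add: eventually_mono)
    then show ?thesis by (simp add: integral_eq_zero_AE)
  next
    case False
    with \<open>m \<ge> 0\<close> have "m > 0" by simp
    define law where "law g = distr (density Q (\<lambda>q. ennreal (g q / m))) borel f" for g
    have law_int: "(\<integral>y. k y \<partial>law g) = (\<integral>q. k (f q) * of_real (g q) \<partial>Q) / m"
      if "integrable Q g" "\<And>q. 0 \<le> g q" "k \<in> borel_measurable borel" for g and k :: "real \<Rightarrow> complex"
    proof -
      have [measurable]: "g \<in> borel_measurable Q" "k \<in> borel_measurable borel" using that by auto
      have "(\<integral>y. k y \<partial>law g) = (\<integral>q. (g q / m) *\<^sub>R k (f q) \<partial>Q)"
        unfolding law_def using that \<open>m > 0\<close> by (subst integral_distr) (auto intro!: integral_density)
      also have "\<dots> = (\<integral>q. (k (f q) * of_real (g q)) / of_real m \<partial>Q)"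
        by (intro Bochner_Integration.integral_cong) (auto simp: scaleR_conv_of_real)
      finally show ?thesis by simp
    qed
    have law_real: "real_distribution (law g)"
      if "integrable Q g" "\<And>q. 0 \<le> g q" "(\<integral>q. g q \<partial>Q) = m" for g
    proof -
      have [measurable]: "g \<in> borel_measurable Q" using that by auto
      have "(\<integral>\<^sup>+q. ennreal (g q / m) \<partial>Q) = 1"
        using that \<open>m > 0\<close> by (subst nn_integral_eq_integral) auto
      then have "prob_space (density Q (\<lambda>q. ennreal (g q / m)))"
        by (intro prob_spaceI) (simp add: emeasure_density cong: nn_integral_cong)
      then have "prob_space (law g)"
        unfolding law_def by (rule prob_space.prob_space_distr) auto
      then show ?thesis unfolding real_distribution_def real_distribution_axioms_def by (auto simp: law_def)
    qed
    have "law hp = law hn"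
    proof (rule Levy_uniqueness)
      show "real_distribution (law hp)" "real_distribution (law hn)"
        using law_real ip im pos m m_def by auto
      show "char (law hp) = char (law hn)"
        unfolding char_def
        using law_int[OF ip pos(1)] law_int[OF im pos(2)] osc by (auto simp: fun_eq_iff)
    qed
    then have "(\<integral>y. indicator A y \<partial>law hp) = (\<integral>y. (indicator A y :: complex) \<partial>law hn)" by simp
    then have "(\<integral>q. indicator A (f q) * of_real (hp q) \<partial>Q) = (\<integral>q. (indicator A (f q) :: complex) * of_real (hn q) \<partial>Q)"
      using law_int[OF ip pos(1)] law_int[OF im pos(2)] \<open>m > 0\<close> by simp
    then have "(\<integral>q. complex_of_real (indicator A (f q) * hp q) \<partial>Q) = (\<integral>q. complex_of_real (indicator A (f q) * hn q) \<partial>Q)"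
      by (simp add: of_real_indicator)
    then show ?thesis by (simp only: integral_complex_of_real of_real_eq_iff)
  qed
  then show ?thesis using int_A[OF ip] int_A[OF im] by (simp add: split right_diff_distrib)
qed

text \<open>
  Complex conjugation replaces \<open>c\<close> by \<open>- c\<close>, so the Fourier transform of the conjugate density vanishes as well, and
  therefore those of the real and of the imaginary part.
\<close>

lemma determining_exp_real:
  "determining Q (borel :: real measure) (range (\<lambda>c y. iexp (c * y)))"
proof (rule determiningI)
  fix h f and A :: "real set"
  assume h: "integrable Q h" and f[measurable]: "f \<in> borel_measurable Q"
    and "\<And>\<phi>. \<phi> \<in> range (\<lambda>c y. iexp (c * y)) \<Longrightarrow> (\<integral>q. \<phi> (f q) * h q \<partial>Q) = 0"
    and A[measurable]: "A \<in> sets borel"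
  then have zero: "(\<integral>q. iexp (c * f q) * h q \<partial>Q) = 0" for c by blast
  have [measurable]: "h \<in> borel_measurable Q" using h by auto
  have int: "integrable Q (\<lambda>q. iexp (c * f q) * h q)" "integrable Q (\<lambda>q. iexp (c * f q) * cnj (h q))" for c
    using h by (auto intro!: integrable_bounded_mult)
  have zero_cnj: "(\<integral>q. iexp (c * f q) * cnj (h q) \<partial>Q) = 0" for c
  proof -
    have "(\<integral>q. iexp (c * f q) * cnj (h q) \<partial>Q) = (\<integral>q. cnj (iexp (- c * f q) * h q) \<partial>Q)"
      by (intro Bochner_Integration.integral_cong) (auto simp: exp_cnj)
    also have "\<dots> = cnj (\<integral>q. iexp (- c * f q) * h q \<partial>Q)" by (rule Bochner_Integration.integral_cnj)
    finally show ?thesis using zero[of "- c"] by simp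
  qed
  have "(\<integral>q. iexp (c * f q) * of_real (Re (h q)) \<partial>Q) = 0" for c
  proof -
    have "(\<integral>q. iexp (c * f q) * of_real (Re (h q)) \<partial>Q)
      = (\<integral>q. (iexp (c * f q) * h q + iexp (c * f q) * cnj (h q)) / 2 \<partial>Q)"
      by (intro Bochner_Integration.integral_cong)
        (auto simp: complex_add_cnj simp flip: distrib_left)
    then show ?thesis using zero[of c] zero_cnj[of c] int[of c] by simp
  qed
  from real_weight_zero_of_fourier_zero[OF integrable_Re[OF h] f this A]
  have re: "(\<integral>q. indicator A (f q) * Re (h q) \<partial>Q) = 0" .
  have "(\<integral>q. iexp (c * f q) * of_real (Im (h q)) \<partial>Q) = 0" for c
  proof -
    have "(\<integral>q. iexp (c * f q) * of_real (Im (h q)) \<partial>Q)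
      = (\<integral>q. (iexp (c * f q) * h q - iexp (c * f q) * cnj (h q)) / (2 * \<i>) \<partial>Q)"
    proof (intro Bochner_Integration.integral_cong refl)
      fix q
      have "of_real (Im (h q)) = (h q - cnj (h q)) / (2 * \<i>)" by (simp add: complex_diff_cnj mult_ac)
      then show "iexp (c * f q) * of_real (Im (h q))
          = (iexp (c * f q) * h q - iexp (c * f q) * cnj (h q)) / (2 * \<i>)"
        by (simp only: times_divide_eq_right right_diff_distrib)
    qed
    then show ?thesis using zero[of c] zero_cnj[of c] int[of c] by simp
  qed
  from real_weight_zero_of_fourier_zero[OF integrable_Im[OF h] f this A]
  have im: "(\<integral>q. indicator A (f q) * Im (h q) \<partial>Q) = 0" .
  have intA: "integrable Q (\<lambda>q. indicator A (f q) * h q)"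
    using h by (intro integrable_bounded_mult) (auto simp: indicator_def)
  have "Re (\<integral>q. indicator A (f q) * h q \<partial>Q) = (\<integral>q. indicator A (f q) * Re (h q) \<partial>Q)"
    unfolding integral_Re[OF intA, symmetric]
    by (intro Bochner_Integration.integral_cong) (auto simp: indicator_def)
  moreover have "Im (\<integral>q. indicator A (f q) * h q \<partial>Q) = (\<integral>q. indicator A (f q) * Im (h q) \<partial>Q)"
    unfolding integral_Im[OF intA, symmetric]
    by (intro Bochner_Integration.integral_cong) (auto simp: indicator_def)
  ultimately show "(\<integral>q. indicator A (f q) * h q \<partial>Q) = 0"
    using re im by (simp add: complex_eq_iff)
qed

text \<open>
  Dynkin's argument for a complex measure instead of a pair of positive ones.
\<close>

lemma integral_indicator_zero_of_generator:
  fixes h :: "'q \<Rightarrow> complex"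
  assumes h: "integrable Q h" and X: "X \<in> measurable Q E"
    and E: "sets E = sigma_sets \<Omega> G" and G: "Int_stable G" "G \<subseteq> Pow \<Omega>" "\<Omega> \<in> G"
    and zero: "\<And>A. A \<in> G \<Longrightarrow> (\<integral>q. indicator A (X q) * h q \<partial>Q) = 0"
    and A: "A \<in> sets E"
  shows "(\<integral>q. indicator A (X q) * h q \<partial>Q) = 0"
proof -
  have \<Omega>: "space E = \<Omega>"
    using E sets.space_closed[of E] sets.top[of E] G(3) sigma_sets_into_sp[OF G(2)]
    by (metis sets.sets_into_space sigma_sets.Basic subset_antisym)
  have [measurable]: "X \<in> measurable Q E" by fact
  have int: "integrable Q (\<lambda>q. indicator B (X q) * h q)" if "B \<in> sets E" for B
    using h that by (intro integrable_bounded_mult) (auto simp: indicator_def)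
  have top: "(\<integral>q. h q \<partial>Q) = 0"
    using zero[OF G(3)] measurable_space[OF X] \<Omega>
    by (simp cong: Bochner_Integration.integral_cong)
  from A have "A \<in> sigma_sets \<Omega> G" using E by simp
  from G(1,2) this show ?thesis
  proof (induction rule: sigma_sets_induct_disjoint)
    case (basic A) then show ?case by (rule zero)
  next
    case empty then show ?case by simp
  next
    case (compl B)
    have "B \<in> sets E" using compl E by simp
    have "(\<integral>q. indicator (\<Omega> - B) (X q) * h q \<partial>Q) = (\<integral>q. h q - indicator B (X q) * h q \<partial>Q)"
      using measurable_space[OF X] \<Omega>
      by (intro Bochner_Integration.integral_cong) (auto simp: indicator_def)
    then show ?case using compl int[OF \<open>B \<in> sets E\<close>] h top by simp
  next
    case (union B)
    have [measurable]: "B i \<in> sets E" for i using union E by auto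
    define C where "C i = X -` B i \<inter> space Q" for i
    have Cm: "C i \<in> sets Q" for i unfolding C_def by measurable
    have eq: "(\<integral>q. indicator S (X q) * h q \<partial>Q) = (LINT q:(X -` S \<inter> space Q)|Q. h q)" for S
      unfolding set_lebesgue_integral_def
      by (intro Bochner_Integration.integral_cong) (auto simp: indicator_def)
    have UC: "X -` (\<Union>i. B i) \<inter> space Q = (\<Union>i. C i)" unfolding C_def by auto
    have "set_integrable Q (\<Union>i. C i) h"
      unfolding set_integrable_def using h Cm by (intro integrable_mult_indicator) auto
    then have "(LINT q:(\<Union>i. C i)|Q. h q) = (\<Sum>i. (LINT q:(C i)|Q. h q))"
      using union(1) Cm
      by (intro lebesgue_integral_countable_add) (auto simp: C_def disjoint_family_on_def)
    also have "\<dots> = 0" using union(3) eq by (simp add: C_def)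
    finally show ?case unfolding eq UC .
  qed
qed

text \<open>
  The variables are exchanged one by one: if the other factors are absorbed into the density, the one-variable
  property turns the test function of one coordinate into an indicator. This gives the rectangles, which generate
  the product \<open>\<sigma>\<close>-algebra.
\<close>

lemma determining_PiM:
  fixes E :: "'b measure"
  assumes fin: "finite J" and det: "determining Q E T"
    and T: "\<And>\<phi>. \<phi> \<in> T \<Longrightarrow> \<phi> \<in> borel_measurable E" "\<And>\<phi> y. \<phi> \<in> T \<Longrightarrow> norm (\<phi> y) \<le> 1"
  shows "determining Q (PiM J (\<lambda>_. E)) {\<lambda>p. \<Prod>j\<in>J. \<phi> j (p j) |\<phi>. \<forall>j\<in>J. \<phi> j \<in> T}"
proof (rule determiningI)
  have box: "(\<integral>q. (\<Prod>j\<in>J. indicator (A j) (F j q)) * h q \<partial>Q) = 0"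
    if "integrable Q h" "\<And>j. j \<in> J \<Longrightarrow> F j \<in> measurable Q E"
      "\<And>\<phi>. (\<And>j. j \<in> J \<Longrightarrow> \<phi> j \<in> T) \<Longrightarrow> (\<integral>q. (\<Prod>j\<in>J. \<phi> j (F j q)) * h q \<partial>Q) = 0"
      "\<And>j. j \<in> J \<Longrightarrow> A j \<in> sets E" for h F A
    using fin that
  proof (induction J arbitrary: h rule: finite_induct)
    case empty
    then show ?case by auto
  next
    case (insert j J)
    have [measurable]: "F j \<in> measurable Q E" "A j \<in> sets E" using insert.prems by auto
    have FJ[measurable]: "F i \<in> measurable Q E" if "i \<in> J" for i using insert.prems that by auto
    define h' where "h' q = indicator (A j) (F j q) * h q" for q
    have "integrable Q h'"
      unfolding h'_def using insert.prems
      by (intro integrable_bounded_mult) (auto simp: indicator_def)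
    moreover have "(\<integral>q. (\<Prod>i\<in>J. \<phi> i (F i q)) * h' q \<partial>Q) = 0" if \<phi>: "\<And>i. i \<in> J \<Longrightarrow> \<phi> i \<in> T" for \<phi>
    proof -
      define k where "k q = (\<Prod>i\<in>J. \<phi> i (F i q)) * h q" for q
      have [measurable]: "(\<lambda>q. \<phi> i (F i q)) \<in> borel_measurable Q" if "i \<in> J" for i
        using T(1)[OF \<phi>[OF that]] FJ[OF that] by (rule measurable_compose[rotated])
      have "integrable Q k"
        unfolding k_def using insert.prems \<phi> T(2)
        by (intro integrable_bounded_mult) (auto simp: prod_norm[symmetric] intro!: prod_le_1)
      moreover have "(\<integral>q. \<psi> (F j q) * k q \<partial>Q) = 0" if "\<psi> \<in> T" for \<psi>
      proof -
        have "(\<Prod>i\<in>insert j J. (if i = j then \<psi> else \<phi> i) (F i q))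
            = \<psi> (F j q) * (\<Prod>i\<in>J. \<phi> i (F i q))" for q
          using insert.hyps by (subst prod.insert) (auto intro!: prod.cong)
        moreover have "(\<integral>q. (\<Prod>i\<in>insert j J. (if i = j then \<psi> else \<phi> i) (F i q)) * h q \<partial>Q) = 0"
          using \<phi> that by (intro insert.prems(3)) auto
        ultimately show ?thesis by (simp only: k_def mult.assoc)
      qed
      ultimately have "(\<integral>q. indicator (A j) (F j q) * k q \<partial>Q) = 0"
        by (intro determiningD[OF det]) auto
      then show ?thesis unfolding k_def h'_def by (simp add: mult_ac)
    qed
    ultimately have "(\<integral>q. (\<Prod>i\<in>J. indicator (A i) (F i q)) * h' q \<partial>Q) = 0"
      using insert.prems by (intro insert.IH) auto
    then show ?case using insert.hyps by (simp add: h'_def mult_ac)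
  qed
  fix h f B
  assume h: "integrable Q h" and f[measurable]: "f \<in> measurable Q (PiM J (\<lambda>_. E))"
    and zero: "\<And>\<phi>. \<phi> \<in> {\<lambda>p. \<Prod>j\<in>J. \<phi> j (p j) |\<phi>. \<forall>j\<in>J. \<phi> j \<in> T} \<Longrightarrow> (\<integral>q. \<phi> (f q) * h q \<partial>Q) = 0"
    and B: "B \<in> sets (PiM J (\<lambda>_. E))"
  show "(\<integral>q. indicator B (f q) * h q \<partial>Q) = 0"
  proof (rule integral_indicator_zero_of_generator[OF h f sets_PiM Int_stable_prod_algebra prod_algebra_sets_into_space _ _ B])
    show "(\<Pi>\<^sub>E i\<in>J. space E) \<in> prod_algebra J (\<lambda>_. E)"
      using fin by (auto simp: prod_algebra_eq_finite)
    fix S assume "S \<in> prod_algebra J (\<lambda>_. E)"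
    then obtain A where S: "S = Pi\<^sub>E J A" and A: "A \<in> (\<Pi> j\<in>J. sets E)"
      using fin by (auto simp: prod_algebra_eq_finite)
    have "(\<integral>q. indicator S (f q) * h q \<partial>Q) = (\<integral>q. (\<Prod>j\<in>J. indicator (A j) (f q j)) * h q \<partial>Q)"
    proof (rule Bochner_Integration.integral_cong)
      fix q assume "q \<in> space Q"
      then have "f q \<in> extensional J" using measurable_space[OF f] by (auto simp: space_PiM PiE_def Pi_def)
      then have "indicator S (f q) = (\<Prod>j\<in>J. indicator (A j) (f q j) :: complex)"
        using fin by (auto simp: S indicator_def PiE_def Pi_iff intro!: prod.neutral)
      then show "indicator S (f q) * h q = (\<Prod>j\<in>J. indicator (A j) (f q j)) * h q" by simp
    qed simp
    also have "\<dots> = 0"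
      using h A zero by (intro box) auto
    finally show "(\<integral>q. indicator S (f q) * h q \<partial>Q) = 0" .
  qed
qed

text \<open>
  Test functions are pulled back along \<open>r\<close> and events along \<open>s\<close>. This carries uniqueness from the tuple of coordinates
  to the vector.
\<close>

lemma determining_retract:
  assumes det: "determining Q E T" and r: "r \<in> measurable E' E" and s: "s \<in> measurable E E'"
    and sr: "\<And>y. y \<in> space E' \<Longrightarrow> s (r y) = y"
  shows "determining Q E' ((\<lambda>\<phi>. \<phi> \<circ> r) ` T)"
proof (rule determiningI)
  fix h f A
  assume h: "integrable Q h" and f: "f \<in> measurable Q E'"
    and zero: "\<And>\<phi>. \<phi> \<in> (\<lambda>\<phi>. \<phi> \<circ> r) ` T \<Longrightarrow> (\<integral>q. \<phi> (f q) * h q \<partial>Q) = 0"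
    and A: "A \<in> sets E'"
  have "(\<integral>q. \<phi> ((r \<circ> f) q) * h q \<partial>Q) = 0" if "\<phi> \<in> T" for \<phi>
    using zero[of "\<phi> \<circ> r"] that by auto
  then have "(\<integral>q. indicator (s -` A \<inter> space E) ((r \<circ> f) q) * h q \<partial>Q) = 0"
    using measurable_sets[OF s A] by (intro determiningD[OF det h measurable_comp[OF f r]])
  moreover have "indicator (s -` A \<inter> space E) ((r \<circ> f) q) = (indicator A (f q) :: complex)" if "q \<in> space Q" for q
    using that measurable_space[OF f] measurable_space[OF r] sr by (auto simp: indicator_def)
  ultimately show "(\<integral>q. indicator A (f q) * h q \<partial>Q) = 0"
    by (simp cong: Bochner_Integration.integral_cong)
qed

lemma determining_exp_vec:
  "determining Q (borel :: (real ^ 'd) measure) (range (\<lambda>u v. iexp (u \<bullet> v)))"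
proof -
  define r where "r v = (\<lambda>k\<in>UNIV. v $ k)" for v :: "real ^ 'd"
  define s :: "('d \<Rightarrow> real) \<Rightarrow> real ^ 'd" where "s p = (\<chi> k. p k)" for p
  let ?T = "{\<lambda>p. \<Prod>j\<in>UNIV. \<phi> j (p j) |\<phi> :: 'd \<Rightarrow> real \<Rightarrow> complex. \<forall>j\<in>UNIV. \<phi> j \<in> range (\<lambda>c y. iexp (c * y))}"
  have "determining Q (\<Pi>\<^sub>M j\<in>(UNIV::'d set). borel) ?T"
    by (rule determining_PiM[OF _ determining_exp_real]) auto
  moreover have "r \<in> measurable borel (\<Pi>\<^sub>M j\<in>UNIV. borel)"
    unfolding r_def by measurable
  moreover have "s \<in> measurable (\<Pi>\<^sub>M j\<in>UNIV. borel) borel"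
    by (subst borel_measurable_euclidean_space) (auto simp: s_def Basis_vec_def inner_axis)
  ultimately have *: "determining Q borel ((\<lambda>\<phi>. \<phi> \<circ> r) ` ?T)"
    by (rule determining_retract) (auto simp: s_def r_def)
  have "(\<lambda>\<phi>. \<phi> \<circ> r) ` ?T \<subseteq> range (\<lambda>u v. iexp (u \<bullet> v))"
  proof
    fix \<psi> assume "\<psi> \<in> (\<lambda>\<phi>. \<phi> \<circ> r) ` ?T"
    then obtain \<phi> :: "'d \<Rightarrow> real \<Rightarrow> complex" where \<psi>: "\<psi> = (\<lambda>p. \<Prod>j\<in>UNIV. \<phi> j (p j)) \<circ> r"
      and "\<forall>j\<in>UNIV. \<phi> j \<in> range (\<lambda>c y. iexp (c * y))" by blast
    then have "\<forall>j. \<exists>c. \<phi> j = (\<lambda>y. iexp (c * y))" by auto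
    then obtain c where c: "\<And>j. \<phi> j = (\<lambda>y. iexp (c j * y))" by metis
    have "(\<lambda>p. \<Prod>j\<in>UNIV. \<phi> j (p j)) \<circ> r = (\<lambda>v. iexp ((\<chi> j. c j) \<bullet> v))"
      unfolding c
      by (auto simp: fun_eq_iff r_def inner_vec_def sum_distrib_left simp flip: exp_sum)
    then show "\<psi> \<in> range (\<lambda>u v. iexp (u \<bullet> v))" unfolding \<psi> by auto
  qed
  with * show ?thesis unfolding determining_def by (meson subsetD)
qed

text \<open>
  Two copies of a measure space side by side, so that one density on their union can compare two laws.
\<close>

lemma integral_pair_bool:
  fixes f :: "bool \<times> 'p \<Rightarrow> complex"
  assumes "sigma_finite_measure M" "\<And>b. integrable M (\<lambda>\<omega>. f (b, \<omega>))"
  shows "integrable (count_space UNIV \<Otimes>\<^sub>M M) f" (is ?I)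
    and "(\<integral>q. f q \<partial>(count_space UNIV \<Otimes>\<^sub>M M)) = (\<integral>\<omega>. f (True, \<omega>) \<partial>M) + (\<integral>\<omega>. f (False, \<omega>) \<partial>M)"
proof -
  interpret sigma_finite_measure M by fact
  interpret B: sigma_finite_measure "count_space (UNIV :: bool set)"
    by (rule sigma_finite_measure_count_space_finite) simp
  interpret pair_sigma_finite "count_space (UNIV :: bool set)" M ..
  have "f \<in> borel_measurable (count_space UNIV \<Otimes>\<^sub>M M)"
    using assms(2) by (intro measurable_pair_measure_countable1) auto
  then show I: ?I
    using assms(2) by (intro Fubini_integrable) (auto simp: integrable_count_space)
  show "(\<integral>q. f q \<partial>(count_space UNIV \<Otimes>\<^sub>M M)) = (\<integral>\<omega>. f (True, \<omega>) \<partial>M) + (\<integral>\<omega>. f (False, \<omega>) \<partial>M)"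
    using integral_fst'[OF I]
    by (simp add: lebesgue_integral_count_space_finite UNIV_bool add.commute)
qed

text \<open>
  On two copies of \<open>M\<close>, take the density \<open>h\<close> on the first and \<open>- k\<close> on the second one: equality of the two
  functionals becomes the vanishing of a single one.
\<close>

lemma determining_two_laws:
  fixes h k :: "'p \<Rightarrow> complex"
  assumes "sigma_finite_measure M"
    and det: "determining (count_space (UNIV :: bool set) \<Otimes>\<^sub>M M) E T"
    and T: "\<And>\<phi>. \<phi> \<in> T \<Longrightarrow> \<phi> \<in> borel_measurable E" "\<And>\<phi> y. \<phi> \<in> T \<Longrightarrow> norm (\<phi> y) \<le> 1"
    and h: "integrable M h" and f[measurable]: "f \<in> measurable M E"
    and k: "integrable M k" and g[measurable]: "g \<in> measurable M E"
    and eq: "\<And>\<phi>. \<phi> \<in> T \<Longrightarrow> (\<integral>\<omega>. \<phi> (f \<omega>) * h \<omega> \<partial>M) = (\<integral>\<omega>. \<phi> (g \<omega>) * k \<omega> \<partial>M)"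
    and A[measurable]: "A \<in> sets E"
  shows "(\<integral>\<omega>. indicator A (f \<omega>) * h \<omega> \<partial>M) = (\<integral>\<omega>. indicator A (g \<omega>) * k \<omega> \<partial>M)"
proof -
  let ?Q = "count_space (UNIV :: bool set) \<Otimes>\<^sub>M M"
  define H where "H = (\<lambda>(b, \<omega>). if b then h \<omega> else - k \<omega>)"
  define F where "F = (\<lambda>(b, \<omega>). if b then f \<omega> else g \<omega>)"
  have test: "integrable ?Q (\<lambda>q. \<phi> (F q) * H q) \<and>
      (\<integral>q. \<phi> (F q) * H q \<partial>?Q) = (\<integral>\<omega>. \<phi> (f \<omega>) * h \<omega> \<partial>M) - (\<integral>\<omega>. \<phi> (g \<omega>) * k \<omega> \<partial>M)"
    if [measurable]: "\<phi> \<in> borel_measurable E" and b: "\<And>y. norm (\<phi> y) \<le> 1" for \<phi>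
  proof -
    have "integrable M (\<lambda>\<omega>. \<phi> (f \<omega>) * h \<omega>)" "integrable M (\<lambda>\<omega>. \<phi> (g \<omega>) * k \<omega>)"
      using h k b by (auto intro!: integrable_bounded_mult)
    then have "integrable M (\<lambda>\<omega>. \<phi> (F (b, \<omega>)) * H (b, \<omega>))" for b
      by (cases b) (auto simp: F_def H_def)
    from integral_pair_bool[OF assms(1), of "\<lambda>q. \<phi> (F q) * H q", OF this]
    show ?thesis by (simp add: F_def H_def)
  qed
  have "integrable ?Q H" using test[of "\<lambda>_. 1"] by simp
  moreover have "F \<in> measurable ?Q E"
    by (intro measurable_pair_measure_countable1) (auto simp: F_def f g)
  moreover have "(\<integral>q. \<phi> (F q) * H q \<partial>?Q) = 0" if "\<phi> \<in> T" for \<phi>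
    using test[of \<phi>] T eq that by auto
  ultimately have "(\<integral>q. indicator A (F q) * H q \<partial>?Q) = 0"
    using A by (intro determiningD[OF det]) auto
  then show ?thesis using test[of "indicator A"] by (simp add: indicator_def)
qed

section \<open>Negative exponentials of extended non-negative numbers\<close>

text \<open>
  The function \<open>a \<mapsto> e\<^sup>-\<^sup>a\<close> with \<open>e\<^sup>-\<^sup>\<infinity> = 0\<close>, so that infinite particle counts need no separate treatment.
\<close>

definition exp_neg :: "ennreal \<Rightarrow> real" where
  "exp_neg a = (if a = \<infinity> then 0 else exp (- enn2real a))"

definition neg_ln :: "real \<Rightarrow> ennreal" where
  "neg_ln p = (if p \<le> 0 then \<infinity> else ennreal (- ln p))"

lemma exp_neg_simps [simp]:
  "exp_neg \<infinity> = 0" "exp_neg top = 0" "exp_neg 0 = 1" "r \<ge> 0 \<Longrightarrow> exp_neg (ennreal r) = exp (- r)"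
  by (auto simp: exp_neg_def)

lemma exp_neg_bounds [simp]: "0 \<le> exp_neg a" "exp_neg a \<le> 1"
  by (auto simp: exp_neg_def)

lemma exp_neg_add: "exp_neg (a + b) = exp_neg a * exp_neg b"
  by (cases a; cases b) (auto simp: mult_exp_exp simp flip: ennreal_plus)

lemma exp_neg_sum: "exp_neg (\<Sum>i\<in>I. a i) = (\<Prod>i\<in>I. exp_neg (a i))"
  by (induction I rule: infinite_finite_induct) (auto simp: exp_neg_add)

lemma exp_neg_of_nat_mult: "exp_neg (of_nat k * a) = exp_neg a ^ k"
  by (induction k) (auto simp: exp_neg_add distrib_right)

lemma exp_neg_antimono: "a \<le> b \<Longrightarrow> exp_neg b \<le> exp_neg a"
  by (cases a; cases b) (auto simp: top_unique)

lemma neg_ln_exp_neg: "neg_ln (exp_neg a) = a"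
  by (cases a) (auto simp: neg_ln_def)

lemma exp_neg_neg_ln: "0 \<le> p \<Longrightarrow> p \<le> 1 \<Longrightarrow> exp_neg (neg_ln p) = p"
  by (auto simp: neg_ln_def)

lemma exp_neg_inject: "exp_neg a = exp_neg b \<longleftrightarrow> a = b"
  by (metis neg_ln_exp_neg)

lemma measurable_exp_neg [measurable]: "exp_neg \<in> borel_measurable borel"
  unfolding exp_neg_def by measurable

lemma measurable_neg_ln [measurable]: "neg_ln \<in> borel_measurable borel"
  unfolding neg_ln_def by measurable

lemma tendsto_exp_neg [tendsto_intros]:
  assumes f: "(f \<longlongrightarrow> a) F"
  shows "((\<lambda>x. exp_neg (f x)) \<longlongrightarrow> exp_neg a) F"
proof (cases a)
  case (real r)
  then have "eventually (\<lambda>x. f x < top) F"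
    using f by (intro order_tendstoD(2)[of _ a]) auto
  moreover have "((\<lambda>x. exp (- enn2real (f x))) \<longlongrightarrow> exp (- r)) F"
    using f real by (intro tendsto_intros) auto
  ultimately have "((\<lambda>x. exp_neg (f x)) \<longlongrightarrow> exp (- r)) F"
    by (subst tendsto_cong[where g="\<lambda>x. exp (- enn2real (f x))"])
      (auto simp: exp_neg_def elim!: eventually_mono)
  then show ?thesis using real by simp
next
  case top
  show ?thesis
  proof (rule order_tendstoI)
    fix y assume "y < exp_neg a"
    then have "y < 0" using top by simp
    then have "y < exp_neg (f x)" for x using exp_neg_bounds(1)[of "f x"] by linarith
    then show "eventually (\<lambda>x. y < exp_neg (f x)) F" by simp
  next
    fix y assume "exp_neg a < y"
    then have "y > 0" using top by simp
    \<comment> \<open>The threshold \<open>- ln y\<close>, raised by one to make the inequality strict.\<close>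
    define K where "K = max 0 (1 - ln y)"
    have "exp (- K) \<le> exp (ln y - 1)" unfolding K_def by simp
    also have "\<dots> < exp (ln y)" by (subst exp_less_cancel_iff) simp
    finally have K: "exp (- K) < y" "0 \<le> K" using \<open>y > 0\<close> by (auto simp: K_def)
    have "eventually (\<lambda>x. ennreal K < f x) F"
      using f top by (intro order_tendstoD(1)[of _ a]) auto
    then show "eventually (\<lambda>x. exp_neg (f x) < y) F"
    proof (rule eventually_mono)
      fix x assume "ennreal K < f x"
      then have "exp_neg (f x) \<le> exp_neg (ennreal K)" by (intro exp_neg_antimono) simp
      then show "exp_neg (f x) < y" using K by simp
    qed
  qed
qed

text \<open>
  A measure on a bounded set is determined by its moments: with \<open>Y = exp_neg (f q)\<close> in the unit interval,
  integrating the exponential series of \<open>e\<^sup>i\<^sup>c\<^sup>Y\<close> term by term gives the Fourier transform, and \<open>neg_ln\<close>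
  recovers \<open>f q\<close> from \<open>Y\<close>.
\<close>

lemma determining_exp_neg_powers:
  "determining Q (borel :: ennreal measure) (range (\<lambda>k a. of_real (exp_neg a ^ k)))"
proof (rule determiningI)
  fix h :: "_ \<Rightarrow> complex" and f and A :: "ennreal set"
  assume h: "integrable Q h" and f[measurable]: "f \<in> borel_measurable Q"
    and zero: "\<And>\<phi>. \<phi> \<in> range (\<lambda>k a. of_real (exp_neg a ^ k)) \<Longrightarrow> (\<integral>q. \<phi> (f q) * h q \<partial>Q) = 0"
    and A[measurable]: "A \<in> sets borel"
  have [measurable]: "h \<in> borel_measurable Q" using h by auto
  define Y where "Y q = exp_neg (f q)" for q
  have [measurable]: "Y \<in> borel_measurable Q" unfolding Y_def by measurable
  have Y: "0 \<le> Y q" "Y q \<le> 1" for q unfolding Y_def by auto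
  have moment: "(\<integral>q. of_real (Y q ^ k) * h q \<partial>Q) = 0" for k
    unfolding Y_def using zero by blast
  have int: "integrable Q (\<lambda>q. of_real (Y q ^ k) * h q)" for k :: nat
    using h Y by (intro integrable_bounded_mult) (simp_all add: norm_power power_le_one)
  have fourier: "(\<integral>q. iexp (c * Y q) * h q \<partial>Q) = 0" for c
  proof -
    define a where "a k = (\<i> * of_real c) ^ k / of_nat (fact k)" for k
    have norm_a: "norm (a k) = \<bar>c\<bar> ^ k / fact k" for k
      by (simp add: a_def norm_divide norm_power norm_mult)
    have sum_a: "summable (\<lambda>k. norm (a k))"
      unfolding norm_a using summable_exp[of "\<bar>c\<bar>"] by (simp add: field_simps)
    have le: "norm (a k * (of_real (Y q ^ k) * h q)) \<le> norm (a k) * norm (h q)" for k q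
      using Y[of q] by (auto simp: norm_mult norm_power power_le_one intro!: mult_left_mono mult_left_le_one_le)
    have "iexp (c * Y q) * h q = (\<Sum>k. a k * (of_real (Y q ^ k) * h q))" for q
    proof -
      have "(\<lambda>k. (\<i> * of_real (c * Y q)) ^ k /\<^sub>R fact k) sums iexp (c * Y q)" by (rule exp_converges)
      then have "(\<lambda>k. ((\<i> * of_real (c * Y q)) ^ k /\<^sub>R fact k) * h q) sums (iexp (c * Y q) * h q)"
        by (rule sums_mult2)
      also have "(\<lambda>k. ((\<i> * of_real (c * Y q)) ^ k /\<^sub>R fact k) * h q) = (\<lambda>k. a k * (of_real (Y q ^ k) * h q))"
        by (auto simp: fun_eq_iff a_def scaleR_conv_of_real power_mult_distrib divide_inverse)
      finally show ?thesis by (simp add: sums_iff)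
    qed
    then have "(\<integral>q. iexp (c * Y q) * h q \<partial>Q) = (\<integral>q. (\<Sum>k. a k * (of_real (Y q ^ k) * h q)) \<partial>Q)" by simp
    also have "\<dots> = (\<Sum>k. \<integral>q. a k * (of_real (Y q ^ k) * h q) \<partial>Q)"
    proof (rule integral_suminf)
      show "integrable Q (\<lambda>q. a k * (of_real (Y q ^ k) * h q))" for k using int by auto
      show "AE q in Q. summable (\<lambda>k. norm (a k * (of_real (Y q ^ k) * h q)))"
        using le by (intro AE_I2 summable_comparison_test'[OF summable_mult2[OF sum_a]]) auto
      show "summable (\<lambda>k. \<integral>q. norm (a k * (of_real (Y q ^ k) * h q)) \<partial>Q)"
      proof (rule summable_comparison_test'[OF summable_mult2[OF sum_a, of "\<integral>q. norm (h q) \<partial>Q"]])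
        fix k :: nat assume "k \<ge> 0"
        have "(\<integral>q. norm (a k * (of_real (Y q ^ k) * h q)) \<partial>Q) \<le> (\<integral>q. norm (a k) * norm (h q) \<partial>Q)"
          using int h le by (intro integral_mono) auto
        then show "norm (\<integral>q. norm (a k * (of_real (Y q ^ k) * h q)) \<partial>Q) \<le> norm (a k) * (\<integral>q. norm (h q) \<partial>Q)"
          by simp
      qed
    qed
    also have "\<dots> = 0" using moment int by simp
    finally show ?thesis .
  qed
  have "(\<integral>q. indicator (neg_ln -` A) (Y q) * h q \<partial>Q) = 0"
    using h fourier measurable_sets[OF measurable_neg_ln A]
    by (intro determiningD[OF determining_exp_real]) auto
  then show "(\<integral>q. indicator A (f q) * h q \<partial>Q) = 0"
    by (simp add: Y_def neg_ln_exp_neg indicator_def)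
qed

lemma measurable_emeasure_measure_algebra [measurable]:
  "B \<in> sets E \<Longrightarrow> (\<lambda>\<mu>. emeasure \<mu> B) \<in> borel_measurable (measure_algebra E)"
  by (auto intro!: measurable_Sup1 measurable_vimage_algebra1 simp: measure_algebra_def)

lemma measurable_nn_integral_measure_algebra [measurable]:
  assumes "f \<in> borel_measurable E"
  shows "(\<lambda>\<mu>. \<integral>\<^sup>+y. f y \<partial>\<mu>) \<in> borel_measurable (measure_algebra E)"
  using assms
proof induct
  case (cong f g)
  moreover have "(\<lambda>\<mu>. \<integral>\<^sup>+y. f y \<partial>\<mu>) \<in> borel_measurable (measure_algebra E) \<longleftrightarrow>
      (\<lambda>\<mu>. \<integral>\<^sup>+y. g y \<partial>\<mu>) \<in> borel_measurable (measure_algebra E)"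
    using cong by (intro measurable_cong nn_integral_cong)
      (auto simp: space_measure_algebra dest!: sets_eq_imp_space_eq)
  ultimately show ?case by simp
next
  case (set B)
  have "(\<lambda>\<mu>. \<integral>\<^sup>+y. indicator B y \<partial>\<mu>) \<in> borel_measurable (measure_algebra E) \<longleftrightarrow>
      (\<lambda>\<mu>. emeasure \<mu> B) \<in> borel_measurable (measure_algebra E)"
    using set by (intro measurable_cong) (auto simp: space_measure_algebra)
  then show ?case using set by simp
next
  case (mult u c)
  have "(\<lambda>\<mu>. \<integral>\<^sup>+y. c * u y \<partial>\<mu>) \<in> borel_measurable (measure_algebra E) \<longleftrightarrow>
      (\<lambda>\<mu>. c * (\<integral>\<^sup>+y. u y \<partial>\<mu>)) \<in> borel_measurable (measure_algebra E)"
    using mult by (intro measurable_cong) (auto simp: space_measure_algebra nn_integral_cmult cong: measurable_cong_sets)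
  then show ?case using mult by simp
next
  case (add u v)
  have "(\<lambda>\<mu>. \<integral>\<^sup>+y. v y + u y \<partial>\<mu>) \<in> borel_measurable (measure_algebra E) \<longleftrightarrow>
      (\<lambda>\<mu>. (\<integral>\<^sup>+y. v y \<partial>\<mu>) + (\<integral>\<^sup>+y. u y \<partial>\<mu>)) \<in> borel_measurable (measure_algebra E)"
    using add by (intro measurable_cong) (auto simp: space_measure_algebra nn_integral_add cong: measurable_cong_sets)
  then show ?case using add by simp
next
  case (seq F)
  have "(\<lambda>\<mu>. \<integral>\<^sup>+y. (SUP i. F i) y \<partial>\<mu>) \<in> borel_measurable (measure_algebra E) \<longleftrightarrow>
      (\<lambda>\<mu>. SUP i. \<integral>\<^sup>+y. F i y \<partial>\<mu>) \<in> borel_measurable (measure_algebra E)"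
    using seq unfolding SUP_apply
    by (intro measurable_cong nn_integral_monotone_convergence_SUP)
      (auto simp: space_measure_algebra cong: measurable_cong_sets)
  then show ?case using seq by simp
qed

section \<open>The Laplace functional of a Poisson process\<close>

context prob_space
begin

lemma integral_exp_neg_poisson:
  assumes X[measurable]: "X \<in> borel_measurable M" and m: "m \<ge> 0"
    and law: "\<And>k::nat. prob {\<omega>\<in>space M. X \<omega> = of_nat k} = m ^ k / fact k * exp (- m)"
    and s: "s > 0"
  shows "(\<integral>\<omega>. exp_neg (ennreal s * X \<omega>) \<partial>M) = exp (- ((1 - exp (- s)) * m))"
proof -
  define D where "D k = {\<omega>\<in>space M. X \<omega> = of_nat k}" for k :: nat
  have [measurable]: "D k \<in> sets M" for k unfolding D_def by measurable
  have disj: "disjoint_family D" unfolding disjoint_family_on_def D_def by auto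
  have pow: "(exp (- s)) ^ k = exp (- (s * real k))" for k
    by (simp add: exp_of_nat_mult[symmetric] mult.commute)
  have series: "(\<lambda>k. y ^ k / fact k * exp (- m)) sums (exp y * exp (- m))" for y :: real
    using sums_mult2[OF exp_converges[of y], of "exp (- m)"] by (simp add: field_simps)
  have "(\<lambda>k. prob (D k)) sums 1"
    using series[of m] by (simp add: D_def law mult_exp_exp)
  moreover have "(\<lambda>k. prob (D k)) sums prob (\<Union>k. D k)"
    using disj by (intro finite_measure_UNION) auto
  ultimately have "prob (\<Union>k. D k) = 1" by (rule sums_unique2[rotated])
  then have AE_D: "AE \<omega> in M. \<omega> \<in> (\<Union>k. D k)" by (subst AE_in_set_eq_1) auto
  have geo: "summable (\<lambda>k. (exp (- s)) ^ k)" using s by (intro summable_geometric) auto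
  have "(\<integral>\<omega>. exp_neg (ennreal s * X \<omega>) \<partial>M) = (\<integral>\<omega>. (\<Sum>k. (exp (- s)) ^ k * indicator (D k) \<omega>) \<partial>M)"
  proof (rule integral_cong_AE)
    show "AE \<omega> in M. exp_neg (ennreal s * X \<omega>) = (\<Sum>k. (exp (- s)) ^ k * indicator (D k) \<omega>)"
      using AE_D
    proof eventually_elim
      case (elim \<omega>)
      then obtain j where j: "\<omega> \<in> D j" by auto
      then have "(\<Sum>k. (exp (- s)) ^ k * indicator (D k) \<omega>) = (\<Sum>k\<in>{j}. (exp (- s)) ^ k * indicator (D k) \<omega>)"
        using disj by (intro suminf_finite) (auto simp: D_def indicator_def)
      moreover have "exp_neg (ennreal s * X \<omega>) = exp (- (s * real j))"
        using j s by (simp add: D_def ennreal_of_nat_eq_real_of_nat flip: ennreal_mult)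
      ultimately show ?case using j by (simp add: pow)
    qed
  qed measurable
  also have "\<dots> = (\<Sum>k. \<integral>\<omega>. (exp (- s)) ^ k * indicator (D k) \<omega> \<partial>M)"
  proof (rule integral_suminf)
    show "AE \<omega> in M. summable (\<lambda>k. norm ((exp (- s)) ^ k * indicator (D k) \<omega>))"
      by (intro AE_I2 summable_comparison_test'[OF geo]) (auto simp: indicator_def)
    show "summable (\<lambda>k. \<integral>\<omega>. norm ((exp (- s)) ^ k * indicator (D k) \<omega>) \<partial>M)"
      by (intro summable_comparison_test'[OF geo]) (auto simp: abs_mult mult_left_le)
  qed (auto simp: emeasure_eq_measure)
  also have "\<dots> = (\<Sum>k. (exp (- s) * m) ^ k / fact k * exp (- m))"
    by (simp add: law D_def[symmetric] power_mult_distrib) (simp add: D_def law mult_ac)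
  also have "\<dots> = exp (exp (- s) * m) * exp (- m)"
    using series[of "exp (- s) * m"] by (rule sums_unique[symmetric])
  also have "\<dots> = exp (- ((1 - exp (- s)) * m))"
    by (simp add: mult_exp_exp algebra_simps)
  finally show ?thesis .
qed

text \<open>
  If \<open>B\<close> has infinite intensity and \<open>a > 0\<close> then both sides are zero.
\<close>

lemma poisson_laplace_set:
  assumes N: "poisson_point_process \<Lambda> N" and B[measurable]: "B \<in> sets \<Lambda>" and a: "a < \<infinity>"
  shows "(\<integral>\<omega>. exp_neg (a * emeasure (N \<omega>) B) \<partial>M) = exp_neg (ennreal (1 - exp_neg a) * emeasure \<Lambda> B)"
proof -
  have [measurable]: "N \<in> measurable M (measure_algebra \<Lambda>)" using N by (simp add: poisson_point_process_def)
  obtain s where s: "s \<ge> 0" "a = ennreal s" using a by (cases a) auto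
  \<comment> \<open>For \<open>s = 0\<close> the left side is \<open>1\<close> even if the count is infinite, as \<open>0 * \<infinity> = 0\<close>.\<close>
  consider "s = 0" | "s > 0" "emeasure \<Lambda> B = \<infinity>" | "s > 0" "emeasure \<Lambda> B < \<infinity>"
    using s by (fastforce simp: less_top)
  then show ?thesis
  proof cases
    case 1
    then show ?thesis using s by (simp add: prob_space)
  next
    case 2
    then have "AE \<omega> in M. emeasure (N \<omega>) B = \<infinity>" using N B by (auto simp: poisson_point_process_def)
    then have "AE \<omega> in M. exp_neg (a * emeasure (N \<omega>) B) = 0"
      using 2 s by (auto elim!: eventually_mono simp: ennreal_mult_top)
    then show ?thesis using 2 s by (simp add: integral_eq_zero_AE ennreal_mult_top)
  next
    case 3
    then have "emeasure \<Lambda> B = ennreal (measure \<Lambda> B)" by (simp add: emeasure_eq_ennreal_measure)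
    moreover have "(\<integral>\<omega>. exp_neg (ennreal s * emeasure (N \<omega>) B) \<partial>M)
        = exp (- ((1 - exp (- s)) * measure \<Lambda> B))"
      using 3 N B by (intro integral_exp_neg_poisson) (auto simp: poisson_point_process_def)
    ultimately show ?thesis using s by (simp flip: ennreal_mult)
  qed
qed

text \<open>
  A simple function is constant on finitely many disjoint sets. The counts of these sets are independent, and
  so the expectation factorises.
\<close>

lemma poisson_laplace_simple:
  assumes N: "poisson_point_process \<Lambda> N" and f: "simple_function \<Lambda> f" "\<And>y. f y < \<infinity>"
  shows "(\<integral>\<omega>. exp_neg (\<integral>\<^sup>+y. f y \<partial>N \<omega>) \<partial>M) = exp_neg (\<integral>\<^sup>+y. ennreal (1 - exp_neg (f y)) \<partial>\<Lambda>)"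
proof -
  have N_meas[measurable]: "N \<in> measurable M (measure_algebra \<Lambda>)"
    using N by (simp add: poisson_point_process_def)
  have "finite (f ` space \<Lambda>)" using f by (simp add: simple_function_def)
  then obtain e where e: "bij_betw e {0..<card (f ` space \<Lambda>)} (f ` space \<Lambda>)"
    using ex_bij_betw_nat_finite by blast
  define n where "n = card (f ` space \<Lambda>)"
  define B where "B i = f -` {e i} \<inter> space \<Lambda>" for i
  have inj: "inj_on e {0..<n}" and img: "e ` {0..<n} = f ` space \<Lambda>"
    using e by (auto simp: bij_betw_def n_def)
  have Bm[measurable]: "B i \<in> sets \<Lambda>" for i
    unfolding B_def using f(1) by (rule simple_functionD)
  have disj: "disjoint_family_on B {0..<n}"
    using inj by (fastforce simp: disjoint_family_on_def B_def inj_on_def)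
  have fin: "e i < \<infinity>" if "i < n" for i
    using that img f(2) by (metis atLeastLessThan_iff imageE image_eqI le0)
  have step: "(\<integral>\<^sup>+y. \<phi> (f y) \<partial>\<mu>) = (\<Sum>i=0..<n. \<phi> (e i) * emeasure \<mu> (B i))"
    if \<mu>: "sets \<mu> = sets \<Lambda>" for \<mu> :: "'b measure" and \<phi> :: "ennreal \<Rightarrow> ennreal"
  proof -
    have "(\<integral>\<^sup>+y. \<phi> (f y) \<partial>\<mu>) = (\<integral>\<^sup>+y. (\<Sum>i=0..<n. \<phi> (e i) * indicator (B i) y) \<partial>\<mu>)"
    proof (rule nn_integral_cong)
      fix y assume "y \<in> space \<mu>"
      then have y: "y \<in> space \<Lambda>" using sets_eq_imp_space_eq[OF \<mu>] by simp
      then obtain j where j: "j < n" "f y = e j"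
        using img by (metis atLeastLessThan_iff imageE image_eqI)
      have "(\<Sum>i=0..<n. \<phi> (e i) * indicator (B i) y) = (\<Sum>i=0..<n. if i = j then \<phi> (e j) else 0)"
        using inj j y by (intro sum.cong) (auto simp: B_def indicator_def dest: inj_onD)
      then show "\<phi> (f y) = (\<Sum>i=0..<n. \<phi> (e i) * indicator (B i) y)" using j by simp
    qed
    also have "\<dots> = (\<Sum>i=0..<n. \<phi> (e i) * emeasure \<mu> (B i))"
      using Bm \<mu> by (subst nn_integral_sum) (auto simp: nn_integral_cmult_indicator cong: measurable_cong_sets)
    finally show ?thesis .
  qed
  have sets_N: "sets (N \<omega>) = sets \<Lambda>" if "\<omega> \<in> space M" for \<omega>
    using measurable_space[OF N_meas that] by (simp add: space_measure_algebra)
  have "(\<integral>\<omega>. exp_neg (\<integral>\<^sup>+y. f y \<partial>N \<omega>) \<partial>M) = (\<integral>\<omega>. (\<Prod>i=0..<n. exp_neg (e i * emeasure (N \<omega>) (B i))) \<partial>M)"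
    using step[OF sets_N, of _ "\<lambda>a. a"]
    by (intro Bochner_Integration.integral_cong) (simp_all add: exp_neg_sum)
  also have "\<dots> = (\<Prod>i=0..<n. \<integral>\<omega>. exp_neg (e i * emeasure (N \<omega>) (B i)) \<partial>M)"
  proof (rule indep_vars_lebesgue_integral)
    have "indep_vars (\<lambda>_. borel) (\<lambda>i \<omega>. emeasure (N \<omega>) (B i)) {0..<n}"
    proof -
      have "\<forall>(I :: nat set) B. finite I \<longrightarrow> B ` I \<subseteq> sets \<Lambda> \<longrightarrow> disjoint_family_on B I \<longrightarrow>
          indep_vars (\<lambda>_. borel) (\<lambda>i \<omega>. emeasure (N \<omega>) (B i)) I"
        using N by (simp add: poisson_point_process_def)
      then show ?thesis using disj Bm by (metis finite_atLeastLessThan image_subsetI)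
    qed
    then show "indep_vars (\<lambda>_. borel) (\<lambda>i \<omega>. exp_neg (e i * emeasure (N \<omega>) (B i))) {0..<n}"
      by (rule indep_vars_compose2[where Y="\<lambda>i a. exp_neg (e i * a)"]) auto
    show "integrable M (\<lambda>\<omega>. exp_neg (e i * emeasure (N \<omega>) (B i)))" for i
      by (rule integrable_const_bound[where B=1]) auto
  qed simp
  also have "\<dots> = (\<Prod>i=0..<n. exp_neg (ennreal (1 - exp_neg (e i)) * emeasure \<Lambda> (B i)))"
    using fin by (intro prod.cong poisson_laplace_set[OF N]) auto
  also have "\<dots> = exp_neg (\<integral>\<^sup>+y. ennreal (1 - exp_neg (f y)) \<partial>\<Lambda>)"
    using step[OF refl, of "\<lambda>a. ennreal (1 - exp_neg a)"] by (simp add: exp_neg_sum)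
  finally show ?thesis .
qed

text \<open>
  Monotone approximation by simple functions. Since \<open>exp_neg\<close> is continuous on all of \<open>[0, \<infinity>]\<close>, the limit is
  allowed even where an integral is infinite.
\<close>

theorem poisson_laplace_functional:
  assumes N: "poisson_point_process \<Lambda> N" and f: "f \<in> borel_measurable \<Lambda>"
  shows "(\<integral>\<omega>. exp_neg (\<integral>\<^sup>+y. f y \<partial>N \<omega>) \<partial>M) = exp_neg (\<integral>\<^sup>+y. ennreal (1 - exp_neg (f y)) \<partial>\<Lambda>)"
proof -
  have N_meas[measurable]: "N \<in> measurable M (measure_algebra \<Lambda>)"
    using N by (simp add: poisson_point_process_def)
  have sets_N: "sets (N \<omega>) = sets \<Lambda>" if "\<omega> \<in> space M" for \<omega>
    using measurable_space[OF N_meas that] by (simp add: space_measure_algebra)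
  obtain g where g: "\<And>i. simple_function \<Lambda> (g i)" "incseq g" "\<And>i y. g i y < top" "\<And>y. (SUP i. g i y) = f y"
    using borel_measurable_implies_simple_function_sequence'[OF f] by metis
  have [measurable]: "g i \<in> borel_measurable \<Lambda>" for i using g(1) by (rule borel_measurable_simple_function)
  have lim: "(\<lambda>i. g i y) \<longlonglongrightarrow> f y" for y
    using LIMSEQ_SUP[of "\<lambda>i. g i y"] g(2,4) by (auto simp: incseq_def le_fun_def)
  have "(\<lambda>i. \<integral>\<omega>. exp_neg (\<integral>\<^sup>+y. g i y \<partial>N \<omega>) \<partial>M) \<longlonglongrightarrow> (\<integral>\<omega>. exp_neg (\<integral>\<^sup>+y. f y \<partial>N \<omega>) \<partial>M)"
  proof (rule integral_dominated_convergence[where w="\<lambda>_. 1"])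
    show "AE \<omega> in M. (\<lambda>i. exp_neg (\<integral>\<^sup>+y. g i y \<partial>N \<omega>)) \<longlonglongrightarrow> exp_neg (\<integral>\<^sup>+y. f y \<partial>N \<omega>)"
    proof (intro AE_I2 tendsto_exp_neg nn_integral_LIMSEQ)
      fix \<omega> i assume "\<omega> \<in> space M"
      then show "g i \<in> borel_measurable (N \<omega>)" using sets_N by (simp cong: measurable_cong_sets)
    qed (use g lim in auto)
  qed (use f in auto)
  moreover have "(\<lambda>i. exp_neg (\<integral>\<^sup>+y. ennreal (1 - exp_neg (g i y)) \<partial>\<Lambda>))
      \<longlonglongrightarrow> exp_neg (\<integral>\<^sup>+y. ennreal (1 - exp_neg (f y)) \<partial>\<Lambda>)"
  proof (intro tendsto_exp_neg nn_integral_LIMSEQ)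
    show "incseq (\<lambda>i y. ennreal (1 - exp_neg (g i y)))"
      using g(2) by (auto simp: incseq_def le_fun_def intro!: ennreal_leI exp_neg_antimono)
    show "(\<lambda>i. ennreal (1 - exp_neg (g i y))) \<longlonglongrightarrow> ennreal (1 - exp_neg (f y))" for y
      by (intro tendsto_intros lim)
  qed auto
  moreover have "(\<integral>\<omega>. exp_neg (\<integral>\<^sup>+y. g i y \<partial>N \<omega>) \<partial>M) = exp_neg (\<integral>\<^sup>+y. ennreal (1 - exp_neg (g i y)) \<partial>\<Lambda>)" for i
    using g by (intro poisson_laplace_simple[OF N]) auto
  ultimately show ?thesis by (simp add: LIMSEQ_unique)
qed

end

section \<open>Laws of moved particles and their intensity measures\<close>

lemma nn_integral_point_config:
  assumes p: "\<And>i. p i \<in> space E" and f: "f \<in> borel_measurable E"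
  shows "(\<integral>\<^sup>+y. f y \<partial>point_config E p) = (\<Sum>i. f (p i))"
  unfolding point_config_def using assms
  by (subst nn_integral_distr) (auto simp: nn_integral_count_space_nat)

lemma exp_neg_suminf: "(\<lambda>m. \<Prod>i<m. exp_neg (a i)) \<longlonglongrightarrow> exp_neg (\<Sum>i. a i)"
  unfolding exp_neg_sum[symmetric] by (intro tendsto_exp_neg summable_LIMSEQ) auto

text \<open>
  An event about a random measure is an event about the family of its values on all measurable sets, which lives in
  a product space indexed by these sets.
\<close>

lemma sets_measure_algebra_vimage:
  assumes S: "S \<in> sets (measure_algebra E)"
  obtains C where "C \<in> sets (\<Pi>\<^sub>M B\<in>sets E. borel)"
    and "S = (\<lambda>\<mu>. \<lambda>B\<in>sets E. emeasure \<mu> B) -` C \<inter> {\<mu>. sets \<mu> = sets E}"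
proof -
  let ?V = "\<lambda>\<mu>. \<lambda>B\<in>sets E. emeasure \<mu> B" and ?R = "\<Pi>\<^sub>M B\<in>sets E. (borel :: ennreal measure)"
  let ?W = "vimage_algebra {\<mu>. sets \<mu> = sets E} ?V ?R"
  have V: "?V \<in> {\<mu>. sets \<mu> = sets E} \<rightarrow> space ?R" by (auto simp: space_PiM)
  then have V_meas: "?V \<in> measurable ?W ?R" by (rule measurable_vimage_algebra1)
  have "(\<lambda>\<mu>. \<mu>) \<in> measurable ?W (measure_algebra E)"
    unfolding measure_algebra_def
  proof (intro measurable_Sup2)
    fix W assume "W \<in> (\<lambda>B. vimage_algebra {\<mu>. sets \<mu> = sets E} (\<lambda>\<mu>. emeasure \<mu> B) borel) ` sets E"
    then obtain B where B: "B \<in> sets E"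
      and W: "W = vimage_algebra {\<mu>. sets \<mu> = sets E} (\<lambda>\<mu>. emeasure \<mu> B) borel" by auto
    have "(\<lambda>\<mu>. ?V \<mu> B) \<in> borel_measurable ?W"
      using B by (intro measurable_compose[OF V_meas measurable_component_singleton]) auto
    then have "(\<lambda>\<mu>. emeasure \<mu> B) \<in> borel_measurable ?W" using B by simp
    then show "(\<lambda>\<mu>. \<mu>) \<in> measurable ?W W"
      unfolding W by (intro measurable_vimage_algebra2) auto
  qed auto
  then have "S \<in> sets ?W"
    using measurable_sets[OF _ S, of "\<lambda>\<mu>. \<mu>" ?W] sets.sets_into_space[OF S]
    by (simp add: space_measure_algebra Int_absorb2)
  then show ?thesis using that by (auto simp: sets_vimage_algebra2[OF V])
qed

context prob_space
begin

text \<open>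
  For \<open>f = \<Sum> k\<^sub>B 1\<^sub>B\<close>, with \<open>B\<close> in a finite family and integers \<open>k\<^sub>B \<ge> 0\<close>, the Laplace functional is the
  mixed moment of order \<open>(k\<^sub>B)\<close> of the variables \<open>exp_neg (N B)\<close>. Bounded mixed moments determine
  the joint law of finitely many counts, and the finite-dimensional laws determine the law of the process.
\<close>

lemma point_process_law_eqI:
  assumes N[measurable]: "N \<in> measurable M (measure_algebra E)"
    and N'[measurable]: "N' \<in> measurable M (measure_algebra E)"
    and laplace: "\<And>f. f \<in> borel_measurable E \<Longrightarrow>
      (\<integral>\<omega>. exp_neg (\<integral>\<^sup>+y. f y \<partial>N \<omega>) \<partial>M) = (\<integral>\<omega>. exp_neg (\<integral>\<^sup>+y. f y \<partial>N' \<omega>) \<partial>M)"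
  shows "distr M (measure_algebra E) N = distr M (measure_algebra E) N'"
proof -
  let ?V = "\<lambda>\<mu>. \<lambda>B\<in>sets E. emeasure \<mu> B" and ?R = "\<Pi>\<^sub>M B\<in>sets E. (borel :: ennreal measure)"
  have V[measurable]: "?V \<in> measurable (measure_algebra E) ?R"
    by (intro measurable_restrict) auto
  have counts: "(\<integral>\<omega>. indicator A (\<lambda>B\<in>J. emeasure (N \<omega>) B) \<partial>M) =
      (\<integral>\<omega>. (indicator A (\<lambda>B\<in>J. emeasure (N' \<omega>) B) :: complex) \<partial>M)"
    if J: "finite J" "J \<subseteq> sets E" and A: "A \<in> sets (\<Pi>\<^sub>M B\<in>J. borel)" for J A
  proof -
    let ?P = "range (\<lambda>(k::nat) a. complex_of_real (exp_neg a ^ k))"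
    let ?T = "{\<lambda>p. \<Prod>j\<in>J. \<phi> j (p j) |\<phi>. \<forall>j\<in>J. \<phi> j \<in> ?P}"
    have P: "\<phi> \<in> borel_measurable borel" "norm (\<phi> y) \<le> 1" if "\<phi> \<in> ?P" for \<phi> y
      using that by (auto simp: norm_power power_le_one)
    have sets_N: "sets (N \<omega>) = sets E" "sets (N' \<omega>) = sets E" if "\<omega> \<in> space M" for \<omega>
      using measurable_space[OF N that] measurable_space[OF N' that] by (simp_all add: space_measure_algebra)
    have prod_laplace: "(\<Prod>B\<in>J. exp_neg (emeasure \<mu> B) ^ k B)
        = exp_neg (\<integral>\<^sup>+y. (\<Sum>B\<in>J. of_nat (k B) * indicator B y) \<partial>\<mu>)"
      if "sets \<mu> = sets E" for \<mu> and k :: "'b set \<Rightarrow> nat"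
    proof -
      have "B \<in> sets \<mu>" if "B \<in> J" for B using that J \<open>sets \<mu> = sets E\<close> by auto
      then show ?thesis
        by (subst nn_integral_sum) (auto simp: nn_integral_cmult_indicator exp_neg_sum exp_neg_of_nat_mult)
    qed
    have det: "determining (count_space (UNIV :: bool set) \<Otimes>\<^sub>M M) (\<Pi>\<^sub>M B\<in>J. borel) ?T"
      by (rule determining_PiM[OF J(1) determining_exp_neg_powers]) (fact P)+
    have "(\<integral>\<omega>. indicator A (\<lambda>B\<in>J. emeasure (N \<omega>) B) * 1 \<partial>M) =
      (\<integral>\<omega>. indicator A (\<lambda>B\<in>J. emeasure (N' \<omega>) B) * (1 :: complex) \<partial>M)"
    proof (rule determining_two_laws[OF _ det])
      show "sigma_finite_measure M" by unfold_locales
      show "(\<lambda>\<omega>. \<lambda>B\<in>J. emeasure (N \<omega>) B) \<in> measurable M (\<Pi>\<^sub>M B\<in>J. borel)"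
        "(\<lambda>\<omega>. \<lambda>B\<in>J. emeasure (N' \<omega>) B) \<in> measurable M (\<Pi>\<^sub>M B\<in>J. borel)"
        using J by (auto intro!: measurable_restrict measurable_compose[OF N] measurable_compose[OF N'])
      fix \<psi> assume \<psi>: "\<psi> \<in> ?T"
      then obtain \<phi> where \<psi>': "\<psi> = (\<lambda>p. \<Prod>j\<in>J. \<phi> j (p j))" and "\<forall>j\<in>J. \<phi> j \<in> ?P"
        by blast
      then have "\<forall>j\<in>J. \<exists>k::nat. \<phi> j = (\<lambda>a. complex_of_real (exp_neg a ^ k))" by auto
      then obtain k' :: "'b set \<Rightarrow> nat" where "\<And>j. j \<in> J \<Longrightarrow> \<phi> j = (\<lambda>a. complex_of_real (exp_neg a ^ k' j))"
        by metis
      with \<psi>' obtain k :: "'b set \<Rightarrow> nat" where k: "\<psi> p = (\<Prod>j\<in>J. complex_of_real (exp_neg (p j) ^ k j))" for p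
        by (simp cong: prod.cong)
      define f where "f y = (\<Sum>B\<in>J. of_nat (k B) * indicator B y :: ennreal)" for y
      have "f \<in> borel_measurable E" unfolding f_def using J
        by (intro borel_measurable_sum borel_measurable_times_ennreal borel_measurable_const
            borel_measurable_indicator) auto
      moreover have "\<psi> (\<lambda>B\<in>J. emeasure \<mu> B) = complex_of_real (exp_neg (\<integral>\<^sup>+y. f y \<partial>\<mu>))"
        if "sets \<mu> = sets E" for \<mu>
        using prod_laplace[OF that, of k] by (simp add: k f_def flip: of_real_prod of_real_power)
      ultimately show "(\<integral>\<omega>. \<psi> (\<lambda>B\<in>J. emeasure (N \<omega>) B) * 1 \<partial>M) = (\<integral>\<omega>. \<psi> (\<lambda>B\<in>J. emeasure (N' \<omega>) B) * 1 \<partial>M)"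
        using laplace[of f] sets_N by (simp cong: Bochner_Integration.integral_cong)
    next
      fix \<psi> y assume "\<psi> \<in> ?T"
      then obtain \<phi> where \<psi>: "\<psi> = (\<lambda>p. \<Prod>j\<in>J. \<phi> j (p j))" and \<phi>: "\<And>j. j \<in> J \<Longrightarrow> \<phi> j \<in> ?P" by blast
      show "\<psi> \<in> borel_measurable (\<Pi>\<^sub>M B\<in>J. borel)"
        unfolding \<psi> using P(1)[OF \<phi>]
        by (intro borel_measurable_prod) (auto intro: measurable_compose[OF measurable_component_singleton])
      show "norm (\<psi> y) \<le> 1"
        unfolding \<psi> using P(2)[OF \<phi>] by (auto simp: prod_norm[symmetric] intro!: prod_le_1)
    qed (use A in auto)
    then show ?thesis by simp
  qed
  have laws: "distr M ?R (\<lambda>\<omega>. ?V (N \<omega>)) = distr M ?R (\<lambda>\<omega>. ?V (N' \<omega>))"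
  proof (rule measure_eqI_PiM_infinite)
    show "finite_measure (distr M ?R (\<lambda>\<omega>. ?V (N \<omega>)))"
      by (intro finite_measure_distr) measurable
    fix A J assume J: "finite J" "J \<subseteq> sets E" and A: "\<And>i. i \<in> J \<Longrightarrow> A i \<in> sets (borel :: ennreal measure)"
    let ?X = "prod_emb (sets E) (\<lambda>_. borel) J (Pi\<^sub>E J A)"
    have X: "?X \<in> sets ?R" using J A by (intro sets_PiM_I) auto
    have box_law: "emeasure (distr M ?R (\<lambda>\<omega>. ?V (K \<omega>))) ?X
        = ennreal (Re (\<integral>\<omega>. indicator (Pi\<^sub>E J A) (\<lambda>B\<in>J. emeasure (K \<omega>) B) \<partial>M))"
      if [measurable]: "K \<in> measurable M (measure_algebra E)" for K
    proof -
      let ?S = "{\<omega> \<in> space M. ?V (K \<omega>) \<in> ?X}"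
      have [measurable]: "?S \<in> sets M" using X by measurable
      have "emeasure (distr M ?R (\<lambda>\<omega>. ?V (K \<omega>))) ?X = emeasure M ?S"
        using X by (subst emeasure_distr) (auto simp: vimage_def Int_def conj_commute)
      moreover have "(\<integral>\<omega>. indicator (Pi\<^sub>E J A) (\<lambda>B\<in>J. emeasure (K \<omega>) B) \<partial>M) = (\<integral>\<omega>. complex_of_real (indicator ?S \<omega>) \<partial>M)"
        using J by (intro Bochner_Integration.integral_cong)
          (auto simp: indicator_def prod_emb_def restrict_restrict Int_absorb1 space_PiM)
      ultimately show ?thesis by (simp add: emeasure_eq_measure)
    qed
    show "emeasure (distr M ?R (\<lambda>\<omega>. ?V (N \<omega>))) ?X = emeasure (distr M ?R (\<lambda>\<omega>. ?V (N' \<omega>))) ?X"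
      unfolding box_law[OF N] box_law[OF N'] using J A by (subst counts) auto
  qed auto
  show ?thesis
  proof (rule measure_eqI)
    fix S assume "S \<in> sets (distr M (measure_algebra E) N)"
    then have S: "S \<in> sets (measure_algebra E)" by simp
    then obtain C where C: "C \<in> sets ?R" and SC: "S = ?V -` C \<inter> {\<mu>. sets \<mu> = sets E}"
      by (rule sets_measure_algebra_vimage)
    have "emeasure (distr M (measure_algebra E) K) S = emeasure (distr M ?R (\<lambda>\<omega>. ?V (K \<omega>))) C"
      if K[measurable]: "K \<in> measurable M (measure_algebra E)" for K
    proof -
      have "K -` S \<inter> space M = (\<lambda>\<omega>. ?V (K \<omega>)) -` C \<inter> space M"
        using measurable_space[OF K] by (auto simp: SC space_measure_algebra)
      then show ?thesis using S C by (simp add: emeasure_distr)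
    qed
    then show "emeasure (distr M (measure_algebra E) N) S = emeasure (distr M (measure_algebra E) N') S"
      using laws N N' by simp
  qed simp
qed

lemma distr_pair_of_indep_elements:
  assumes "indep_elements S X T Y"
  shows "distr M (S \<Otimes>\<^sub>M T) (\<lambda>\<omega>. (X \<omega>, Y \<omega>)) = distr M S X \<Otimes>\<^sub>M distr M T Y"
proof (rule pair_measure_eqI[symmetric])
  have X[measurable]: "X \<in> measurable M S" and Y[measurable]: "Y \<in> measurable M T"
    and ind: "indep_set {X -` A \<inter> space M |A. A \<in> sets S} {Y -` B \<inter> space M |B. B \<in> sets T}"
    using assms by (auto simp: indep_elements_def)
  show "sigma_finite_measure (distr M S X)" "sigma_finite_measure (distr M T Y)"
    by (auto intro!: prob_space_imp_sigma_finite prob_space_distr)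
  show "sets (distr M S X \<Otimes>\<^sub>M distr M T Y) = sets (distr M (S \<Otimes>\<^sub>M T) (\<lambda>\<omega>. (X \<omega>, Y \<omega>)))"
    by (simp cong: sets_pair_measure_cong)
  fix A B assume "A \<in> sets (distr M S X)" "B \<in> sets (distr M T Y)"
  then have A: "A \<in> sets S" and B: "B \<in> sets T" by auto
  have "prob ((X -` A \<inter> space M) \<inter> (Y -` B \<inter> space M)) = prob (X -` A \<inter> space M) * prob (Y -` B \<inter> space M)"
    using A B by (intro indep_setD[OF ind]) auto
  moreover have "(\<lambda>\<omega>. (X \<omega>, Y \<omega>)) -` (A \<times> B) \<inter> space M = (X -` A \<inter> space M) \<inter> (Y -` B \<inter> space M)" by auto
  ultimately show "emeasure (distr M S X) A * emeasure (distr M T Y) B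
      = emeasure (distr M (S \<Otimes>\<^sub>M T) (\<lambda>\<omega>. (X \<omega>, Y \<omega>))) (A \<times> B)"
    using A B by (simp add: emeasure_distr emeasure_eq_measure ennreal_mult)
qed

end

definition particle_intensity ::
    "(real ^ 'd) measure \<Rightarrow> 'p measure \<Rightarrow> (real \<Rightarrow> 'p \<Rightarrow> real ^ 'd) \<Rightarrow> nat \<Rightarrow> (nat \<Rightarrow> real) \<Rightarrow>
     (nat \<Rightarrow> real ^ 'd) measure" where
  "particle_intensity \<Lambda> P \<xi> n t =
     distr (\<Lambda> \<Otimes>\<^sub>M P) (tuple_space n) (\<lambda>(y, \<omega>). \<lambda>j\<in>{1..n}. y + \<xi> (t j) \<omega>)"

context particle_system
begin

lemma measurable_point [measurable]: "x i \<in> borel_measurable M"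
proof -
  have "(\<lambda>\<omega> i. x i \<omega>) \<in> measurable M (\<Pi>\<^sub>M i\<in>UNIV. borel)"
    using points_copies_indep by (simp add: indep_elements_def)
  from measurable_compose[OF this measurable_component_singleton, of i] show ?thesis by simp
qed

lemma measurable_motions: "(\<lambda>\<omega> t. \<Xi> i t \<omega>) \<in> measurable M (\<Pi>\<^sub>M t\<in>UNIV. borel)"
  using copies_indep by (auto simp: indep_vars_def)

lemma measurable_motion [measurable]: "\<Xi> i t \<in> borel_measurable M"
  using measurable_compose[OF measurable_motions measurable_component_singleton, of t i] by simp

lemma measurable_particles: "particles x \<Xi> n t \<in> measurable M (measure_algebra (tuple_space n))"
  unfolding particles_def by (rule measurable_point_config) measurable

text \<open>
  Given the starting points, the motions are still independent and distributed like \<open>\<xi>\<close>, so that they can be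
  integrated out one by one. For \<open>c = exp (- f)\<close> the product over the first \<open>m\<close> particles approximates
  \<open>exp (- \<integral> f dN)\<close>; keeping it finite lets the expectation of the product split into finitely many factors.
\<close>

lemma integral_prod_marked:
  assumes \<xi>: "\<And>t. \<xi> t \<in> borel_measurable P"
    and c[measurable]: "c \<in> borel_measurable (tuple_space n)" and c01: "\<And>z. 0 \<le> c z" "\<And>z. c z \<le> (1::real)"
  shows "(\<integral>\<omega>. (\<Prod>i<m. c (\<lambda>j\<in>{1..n}. x i \<omega> + \<Xi> i (t j) \<omega>)) \<partial>M)
       = (\<integral>\<omega>. (\<Prod>i<m. \<integral>\<eta>. c (\<lambda>j\<in>{1..n}. x i \<omega> + \<xi> (t j) \<eta>) \<partial>P) \<partial>M)"
proof -
  let ?S = "\<Pi>\<^sub>M i\<in>(UNIV::nat set). (borel :: (real ^ 'd) measure)"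
  let ?U = "\<Pi>\<^sub>M t\<in>(UNIV::real set). (borel :: (real ^ 'd) measure)"
  let ?T = "\<Pi>\<^sub>M i\<in>(UNIV::nat set). ?U"
  let ?X = "\<lambda>\<omega> i. x i \<omega>" and ?Z = "\<lambda>\<omega> i t. \<Xi> i t \<omega>"
  have X: "?X \<in> measurable M ?S" and Z: "?Z \<in> measurable M ?T"
    using points_copies_indep by (auto simp: indep_elements_def)
  have \<xi>': "(\<lambda>\<omega> t. \<xi> t \<omega>) \<in> measurable P ?U" using \<xi> by (intro measurable_PiM_single') auto
  define F where "F = (\<lambda>(p, z). \<Prod>i<m. c (\<lambda>j\<in>{1..n}. p i + z i (t j)))"
  have [measurable]: "(\<lambda>q. fst q i) \<in> borel_measurable (?S \<Otimes>\<^sub>M ?T)" for i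
    by (rule measurable_compose[OF measurable_fst measurable_component_singleton]) simp
  have [measurable]: "(\<lambda>q. snd q i r) \<in> borel_measurable (?S \<Otimes>\<^sub>M ?T)" for i r
  proof -
    have "(\<lambda>q. snd q i) \<in> measurable (?S \<Otimes>\<^sub>M ?T) ?U"
      by (rule measurable_compose[OF measurable_snd measurable_component_singleton]) simp
    from measurable_compose[OF this measurable_component_singleton, of r] show ?thesis by simp
  qed
  have F[measurable]: "F \<in> borel_measurable (?S \<Otimes>\<^sub>M ?T)"
    unfolding F_def case_prod_beta by measurable
  have F01: "norm (F q) \<le> 1" for q
    unfolding F_def using c01 by (auto simp: prod_nonneg split: prod.split intro!: prod_le_1)
  interpret DX: prob_space "distr M ?S ?X" using X by (rule prob_space_distr)
  interpret DZ: prob_space "distr M ?T ?Z" using Z by (rule prob_space_distr)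
  interpret D: pair_prob_space "distr M ?S ?X" "distr M ?T ?Z" ..
  have inner: "(\<integral>\<omega>'. F (p, ?Z \<omega>') \<partial>M) = (\<Prod>i<m. \<integral>\<eta>. c (\<lambda>j\<in>{1..n}. p i + \<xi> (t j) \<eta>) \<partial>P)" for p
  proof -
    have cm: "(\<lambda>z. c (\<lambda>j\<in>{1..n}. y + z (t j))) \<in> borel_measurable ?U" for y by measurable
    have prod: "(\<integral>\<omega>'. F (p, ?Z \<omega>') \<partial>M) = (\<Prod>i<m. \<integral>\<omega>'. c (\<lambda>j\<in>{1..n}. p i + \<Xi> i (t j) \<omega>') \<partial>M)"
      unfolding F_def prod.case
    proof (rule indep_vars_lebesgue_integral)
      have "indep_vars (\<lambda>_. ?U) (\<lambda>i \<omega> t. \<Xi> i t \<omega>) {..<m}"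
        using copies_indep by (rule indep_vars_subset) auto
      then show "indep_vars (\<lambda>_. borel) (\<lambda>i \<omega>'. c (\<lambda>j\<in>{1..n}. p i + \<Xi> i (t j) \<omega>')) {..<m}"
        by (rule indep_vars_compose2[where Y="\<lambda>i z. c (\<lambda>j\<in>{1..n}. p i + z (t j))"]) (rule cm)
      show "integrable M (\<lambda>\<omega>'. c (\<lambda>j\<in>{1..n}. p i + \<Xi> i (t j) \<omega>'))" for i
      proof (rule integrable_const_bound[where B=1])
        show "AE \<omega>' in M. norm (c (\<lambda>j\<in>{1..n}. p i + \<Xi> i (t j) \<omega>')) \<le> 1" using c01 by auto
      qed measurable
    qed simp
    have "(\<integral>\<omega>'. c (\<lambda>j\<in>{1..n}. p i + \<Xi> i (t j) \<omega>') \<partial>M) = (\<integral>\<eta>. c (\<lambda>j\<in>{1..n}. p i + \<xi> (t j) \<eta>) \<partial>P)" for i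
    proof -
      have "(\<integral>z. c (\<lambda>j\<in>{1..n}. p i + z (t j)) \<partial>distr M ?U (\<lambda>\<omega> t. \<Xi> i t \<omega>))
          = (\<integral>z. c (\<lambda>j\<in>{1..n}. p i + z (t j)) \<partial>distr P ?U (\<lambda>\<omega> t. \<xi> t \<omega>))"
        by (simp only: copies_distr)
      then show ?thesis
        using integral_distr[OF measurable_motions cm, of i "p i"] integral_distr[OF \<xi>' cm, of "p i"] by simp
    qed
    then show ?thesis unfolding prod by simp
  qed
  have "(\<integral>\<omega>. F (?X \<omega>, ?Z \<omega>) \<partial>M) = (\<integral>q. F q \<partial>distr M (?S \<Otimes>\<^sub>M ?T) (\<lambda>\<omega>. (?X \<omega>, ?Z \<omega>)))"
    using X Z by (subst integral_distr) auto
  also have "\<dots> = (\<integral>q. F q \<partial>(distr M ?S ?X \<Otimes>\<^sub>M distr M ?T ?Z))"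
    unfolding distr_pair_of_indep_elements[OF points_copies_indep] ..
  also have "\<dots> = (\<integral>p. \<integral>z. F (p, z) \<partial>distr M ?T ?Z \<partial>distr M ?S ?X)"
    using F F01 by (intro D.integral_fst'[symmetric] D.integrable_const_bound[where B=1])
      (auto cong: measurable_cong_sets sets_pair_measure_cong)
  also have "\<dots> = (\<integral>\<omega>. \<integral>z. F (?X \<omega>, z) \<partial>distr M ?T ?Z \<partial>M)"
    using X by (intro integral_distr DZ.borel_measurable_lebesgue_integral) (auto cong: measurable_cong_sets sets_pair_measure_cong)
  also have "\<dots> = (\<integral>\<omega>. \<integral>\<omega>'. F (?X \<omega>, ?Z \<omega>') \<partial>M \<partial>M)"
    using Z by (intro Bochner_Integration.integral_cong refl integral_distr measurable_compose[OF measurable_Pair1' F])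
      (auto simp: space_PiM)
  finally show ?thesis unfolding inner by (simp add: F_def)
qed

text \<open>
  Averaging over the motions replaces the factor \<open>exp_neg (f z)\<close> of a particle that started in \<open>y\<close> by
  \<open>g y = E exp_neg (f (y + \<xi>))\<close>. The moved system therefore has at \<open>f\<close> the Laplace functional of the starting points
  at \<open>neg_ln \<circ> g\<close>, which the Poisson formula evaluates as \<open>\<integral> (1 - g) d\<Lambda>\<close>.
\<close>

lemma particles_laplace_functional:
  assumes P: "prob_space P" and \<xi>[measurable]: "\<And>t. \<xi> t \<in> borel_measurable P"
    and f[measurable]: "f \<in> borel_measurable (tuple_space n)"
  shows "(\<integral>\<omega>. exp_neg (\<integral>\<^sup>+z. f z \<partial>particles x \<Xi> n t \<omega>) \<partial>M)
       = exp_neg (\<integral>\<^sup>+z. ennreal (1 - exp_neg (f z)) \<partial>particle_intensity \<Lambda> P \<xi> n t)"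
proof -
  interpret P: prob_space P by fact
  note [measurable_cong] = sets_intensity
  define pt where "pt y \<eta> = (\<lambda>j\<in>{1..n}. y + \<xi> (t j) \<eta>)" for y \<eta>
  have pt[measurable]: "(\<lambda>(y, \<eta>). pt y \<eta>) \<in> measurable (borel \<Otimes>\<^sub>M P) (tuple_space n)"
    unfolding pt_def by measurable
  have pt'[measurable]: "(\<lambda>\<eta>. pt y \<eta>) \<in> measurable P (tuple_space n)" for y
    unfolding pt_def by measurable
  define g where "g y = (\<integral>\<eta>. exp_neg (f (pt y \<eta>)) \<partial>P)" for y
  have int: "integrable P (\<lambda>\<eta>. exp_neg (f (pt y \<eta>)))" for y
    by (intro P.integrable_const_bound[where B=1]) auto
  have g[measurable]: "g \<in> borel_measurable borel"
    unfolding g_def by measurable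
  have g01: "0 \<le> g y" "g y \<le> 1" for y
  proof -
    show "0 \<le> g y" unfolding g_def by simp
    have "g y \<le> (\<integral>\<eta>. 1 \<partial>P)" unfolding g_def using int by (intro integral_mono) auto
    then show "g y \<le> 1" by (simp add: P.prob_space)
  qed
  have parts: "(\<integral>\<^sup>+z. f z \<partial>particles x \<Xi> n t \<omega>) = (\<Sum>i. f (\<lambda>j\<in>{1..n}. x i \<omega> + \<Xi> i (t j) \<omega>))" for \<omega>
    unfolding particles_def by (intro nn_integral_point_config f) (auto simp: space_PiM)
  have pts: "(\<integral>\<^sup>+y. neg_ln (g y) \<partial>point_config borel (\<lambda>i. x i \<omega>)) = (\<Sum>i. neg_ln (g (x i \<omega>)))" for \<omega>
    by (intro nn_integral_point_config) auto
  have lim1: "(\<lambda>m. \<integral>\<omega>. (\<Prod>i<m. exp_neg (a i \<omega>)) \<partial>M) \<longlonglongrightarrow> (\<integral>\<omega>. exp_neg (\<Sum>i. a i \<omega>) \<partial>M)"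
    if [measurable]: "\<And>i. a i \<in> borel_measurable M" for a
    by (rule integral_dominated_convergence[where w="\<lambda>_. 1"])
      (auto intro!: exp_neg_suminf prod_le_1 simp: abs_prod)
  \<comment> \<open>Both sides are limits of expectations of the same finite products.\<close>
  have "(\<integral>\<omega>. exp_neg (\<integral>\<^sup>+z. f z \<partial>particles x \<Xi> n t \<omega>) \<partial>M)
      = (\<integral>\<omega>. exp_neg (\<integral>\<^sup>+y. neg_ln (g y) \<partial>point_config borel (\<lambda>i. x i \<omega>)) \<partial>M)"
    unfolding parts pts
  proof (rule LIMSEQ_unique[OF lim1])
    have "(\<integral>\<omega>. (\<Prod>i<m. exp_neg (f (\<lambda>j\<in>{1..n}. x i \<omega> + \<Xi> i (t j) \<omega>))) \<partial>M)
        = (\<integral>\<omega>. (\<Prod>i<m. exp_neg (neg_ln (g (x i \<omega>)))) \<partial>M)" for m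
    proof -
      have "(\<lambda>z. exp_neg (f z)) \<in> borel_measurable (tuple_space n)" by measurable
      from integral_prod_marked[OF \<xi> this exp_neg_bounds, of t m]
      show ?thesis by (simp only: exp_neg_neg_ln[OF g01]) (simp only: g_def pt_def)
    qed
    then show "(\<lambda>m. \<integral>\<omega>. (\<Prod>i<m. exp_neg (f (\<lambda>j\<in>{1..n}. x i \<omega> + \<Xi> i (t j) \<omega>))) \<partial>M)
        \<longlonglongrightarrow> (\<integral>\<omega>. exp_neg (\<Sum>i. neg_ln (g (x i \<omega>))) \<partial>M)"
      using lim1[of "\<lambda>i \<omega>. neg_ln (g (x i \<omega>))"] by simp
  qed measurable
  also have "\<dots> = exp_neg (\<integral>\<^sup>+y. ennreal (1 - g y) \<partial>\<Lambda>)"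
    by (subst poisson_laplace_functional[OF points]) (auto simp: exp_neg_neg_ln g01)
  also have "(\<integral>\<^sup>+y. ennreal (1 - g y) \<partial>\<Lambda>) = (\<integral>\<^sup>+y. \<integral>\<^sup>+\<eta>. ennreal (1 - exp_neg (f (pt y \<eta>))) \<partial>P \<partial>\<Lambda>)"
  proof (rule nn_integral_cong)
    fix y
    have "(\<integral>\<^sup>+\<eta>. ennreal (1 - exp_neg (f (pt y \<eta>))) \<partial>P) = ennreal (\<integral>\<eta>. 1 - exp_neg (f (pt y \<eta>)) \<partial>P)"
      using int by (intro nn_integral_eq_integral) auto
    then show "ennreal (1 - g y) = (\<integral>\<^sup>+\<eta>. ennreal (1 - exp_neg (f (pt y \<eta>))) \<partial>P)"
      using int by (simp add: g_def P.prob_space)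
  qed
  also have "\<dots> = (\<integral>\<^sup>+q. ennreal (1 - exp_neg (f (case q of (y, \<eta>) \<Rightarrow> pt y \<eta>))) \<partial>(\<Lambda> \<Otimes>\<^sub>M P))"
    by (subst P.nn_integral_fst[symmetric]) auto
  also have "\<dots> = (\<integral>\<^sup>+z. ennreal (1 - exp_neg (f z)) \<partial>particle_intensity \<Lambda> P \<xi> n t)"
    unfolding particle_intensity_def pt_def[symmetric]
  proof (rule nn_integral_distr[symmetric])
    show "(\<lambda>(y, \<eta>). pt y \<eta>) \<in> measurable (\<Lambda> \<Otimes>\<^sub>M P) (tuple_space n)" by measurable
    show "(\<lambda>z. ennreal (1 - exp_neg (f z))) \<in> borel_measurable (distr (\<Lambda> \<Otimes>\<^sub>M P) (tuple_space n) (\<lambda>(y, \<eta>). pt y \<eta>))" by measurable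
  qed
  finally show ?thesis .
qed

text \<open>
  The Laplace functional depends on the times only through the intensity. Conversely, its value at the
  indicator of \<open>B\<close> is \<open>exp_neg ((1 - 1/e) \<Lambda>\<^sub>t B)\<close>, which gives \<open>\<Lambda>\<^sub>t B\<close> even if that is infinite.
\<close>

theorem particles_law_eq_iff_intensity_eq:
  assumes P: "prob_space P" and \<xi>: "\<And>t. \<xi> t \<in> borel_measurable P"
  shows "distr M (measure_algebra (tuple_space n)) (particles x \<Xi> n t)
       = distr M (measure_algebra (tuple_space n)) (particles x \<Xi> n t')
     \<longleftrightarrow> particle_intensity \<Lambda> P \<xi> n t = particle_intensity \<Lambda> P \<xi> n t'" (is "?D t = ?D t' \<longleftrightarrow> ?I t = ?I t'")
proof
  assume "?I t = ?I t'"
  then show "?D t = ?D t'"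
    by (intro point_process_law_eqI measurable_particles) (simp add: particles_laplace_functional[OF P \<xi>])
next
  assume D: "?D t = ?D t'"
  show "?I t = ?I t'"
  proof (rule measure_eqI)
    show "sets (?I t) = sets (?I t')" by (simp add: particle_intensity_def)
    fix B assume "B \<in> sets (?I t)"
    then have B: "B \<in> sets (tuple_space n)" by (simp add: particle_intensity_def)
    have law: "(\<integral>\<mu>. exp_neg (\<integral>\<^sup>+z. indicator B z \<partial>\<mu>) \<partial>?D r) = exp_neg (ennreal (1 - exp (- 1)) * emeasure (?I r) B)" for r
    proof -
      have "(\<integral>\<mu>. exp_neg (\<integral>\<^sup>+z. indicator B z \<partial>\<mu>) \<partial>?D r) = (\<integral>\<omega>. exp_neg (\<integral>\<^sup>+z. indicator B z \<partial>particles x \<Xi> n r \<omega>) \<partial>M)"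
        using B by (intro integral_distr measurable_particles
            measurable_compose[OF measurable_nn_integral_measure_algebra measurable_exp_neg]) auto
      also have "\<dots> = exp_neg (\<integral>\<^sup>+z. ennreal (1 - exp_neg (indicator B z)) \<partial>?I r)"
        using B by (intro particles_laplace_functional[OF P \<xi>]) auto
      also have "(\<integral>\<^sup>+z. ennreal (1 - exp_neg (indicator B z)) \<partial>?I r) = (\<integral>\<^sup>+z. ennreal (1 - exp (- 1)) * indicator B z \<partial>?I r)"
        using exp_neg_simps(4)[of 1] by (intro nn_integral_cong) (auto simp: indicator_def)
      also have "\<dots> = ennreal (1 - exp (- 1)) * emeasure (?I r) B"
        using B by (intro nn_integral_cmult_indicator) (simp add: particle_intensity_def)
      finally show ?thesis .
    qed
    have "exp_neg (ennreal (1 - exp (- 1)) * emeasure (?I t) B) = exp_neg (ennreal (1 - exp (- 1)) * emeasure (?I t') B)"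
      using law[of t] law[of t'] D by simp
    then show "emeasure (?I t) B = emeasure (?I t') B"
      by (simp add: exp_neg_inject ennreal_mult_cancel_left)
  qed
qed

end

section \<open>Intensities and characteristic functions for an exponential measure\<close>

lemma sets_exp_measure [simp, measurable_cong]: "sets (exp_measure l) = sets borel"
  by (simp add: exp_measure_def)

lemma space_exp_measure [simp]: "space (exp_measure l) = UNIV"
  by (simp add: exp_measure_def)

lemma sigma_finite_exp_measure: "sigma_finite_measure (exp_measure l)"
  unfolding exp_measure_def by (subst sigma_finite_measure.sigma_finite_iff_density_finite[OF sigma_finite_lborel]) auto

text \<open>
  On the unit ball the density lies between \<open>exp (- norm l)\<close> and \<open>exp (norm l)\<close>.
\<close>

lemma emeasure_exp_measure_ball:
  fixes l :: "real ^ 'd"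
  shows "0 < emeasure (exp_measure l) (ball 0 1)" "emeasure (exp_measure l) (ball 0 1) < \<infinity>"
proof -
  let ?K = "ball (0 :: real ^ 'd) 1"
  have em: "emeasure (exp_measure l) ?K = (\<integral>\<^sup>+y. ennreal (exp (- (l \<bullet> y))) * indicator ?K y \<partial>lborel)"
    unfolding exp_measure_def by (intro emeasure_density) auto
  have dot: "\<bar>l \<bullet> y\<bar> \<le> norm l" if "y \<in> ?K" for y
  proof -
    have "\<bar>l \<bullet> y\<bar> \<le> norm l * norm y" by (rule Cauchy_Schwarz_ineq2)
    also have "\<dots> \<le> norm l" using that by (intro mult_left_le) auto
    finally show ?thesis .
  qed
  have vol: "emeasure lborel ?K < \<infinity>" "0 < emeasure lborel ?K"
    using emeasure_lborel_ball_finite[of 0 1] content_ball_pos[of 1 "0 :: real ^ 'd"]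
    by (auto simp: less_top measure_def enn2real_positive_iff)
  have "emeasure (exp_measure l) ?K \<le> (\<integral>\<^sup>+y. ennreal (exp (norm l)) * indicator ?K y \<partial>lborel)"
    unfolding em
  proof (rule nn_integral_mono)
    fix y show "ennreal (exp (- (l \<bullet> y))) * indicator ?K y \<le> ennreal (exp (norm l)) * indicator ?K y"
      using dot[of y] by (cases "y \<in> ?K") (auto intro!: ennreal_leI)
  qed
  also have "\<dots> = ennreal (exp (norm l)) * emeasure lborel ?K" by (intro nn_integral_cmult_indicator) auto
  also have "\<dots> < \<infinity>" using vol by (simp add: ennreal_mult_less_top)
  finally show "emeasure (exp_measure l) ?K < \<infinity>" .
  have "0 < ennreal (exp (- norm l)) * emeasure lborel ?K" using vol by (simp add: ennreal_zero_less_mult_iff)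
  also have "\<dots> = (\<integral>\<^sup>+y. ennreal (exp (- norm l)) * indicator ?K y \<partial>lborel)"
    by (intro nn_integral_cmult_indicator[symmetric]) auto
  also have "\<dots> \<le> emeasure (exp_measure l) ?K"
    unfolding em
  proof (rule nn_integral_mono)
    fix y show "ennreal (exp (- norm l)) * indicator ?K y \<le> ennreal (exp (- (l \<bullet> y))) * indicator ?K y"
      using dot[of y] by (cases "y \<in> ?K") (auto intro!: ennreal_leI)
  qed
  finally show "0 < emeasure (exp_measure l) ?K" .
qed

locale exponential_moment_process = prob_space P
  for P :: "'p measure" +
  fixes l :: "real ^ 'd" and \<xi> :: "real \<Rightarrow> 'p \<Rightarrow> real ^ 'd"
  assumes measurable_process [measurable]: "\<And>t. \<xi> t \<in> borel_measurable P"
    and exponential_moment: "\<And>t. (\<integral>\<^sup>+\<omega>. ennreal (exp (l \<bullet> \<xi> t \<omega>)) \<partial>P) < \<infinity>"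
begin

text \<open>
  The exponential change of measure (Esscher transform) of the process at time \<open>r\<close>, not normalised.
\<close>

definition tilted :: "real \<Rightarrow> 'p measure" where
  "tilted r = density P (\<lambda>\<omega>. ennreal (exp (l \<bullet> \<xi> r \<omega>)))"

lemma sets_tilted [simp, measurable_cong]: "sets (tilted r) = sets P"
  by (simp add: tilted_def)

lemma space_tilted [simp]: "space (tilted r) = space P"
  by (simp add: tilted_def)

lemma finite_measure_tilted: "finite_measure (tilted r)"
  using exponential_moment[of r]
  by (intro finite_measureI) (simp add: tilted_def emeasure_density cong: nn_integral_cong)

definition increments :: "nat \<Rightarrow> (nat \<Rightarrow> real) \<Rightarrow> 'p \<Rightarrow> nat \<Rightarrow> real ^ 'd" where
  "increments n t \<omega> = (\<lambda>j\<in>{1..n}. \<xi> (t j) \<omega> - \<xi> (t 1) \<omega>)"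

lemma measurable_increments [measurable]: "increments n t \<in> measurable P (tuple_space n)"
  unfolding increments_def by measurable

definition translate :: "nat \<Rightarrow> real ^ 'd \<Rightarrow> (nat \<Rightarrow> real ^ 'd) \<Rightarrow> nat \<Rightarrow> real ^ 'd" where
  "translate n y z = (\<lambda>j\<in>{1..n}. y + z j)"

lemma measurable_translate:
  "(\<lambda>(y, z). translate n y z) \<in> measurable (borel \<Otimes>\<^sub>M tuple_space n) (tuple_space n)"
  unfolding translate_def by measurable

lemma measurable_translate_increments [measurable]:
  "(\<lambda>(y, \<omega>). translate n y (increments n t \<omega>)) \<in> measurable (borel \<Otimes>\<^sub>M P) (tuple_space n)"
proof -
  have "(\<lambda>q. (fst q, increments n t (snd q))) \<in> measurable (borel \<Otimes>\<^sub>M P) (borel \<Otimes>\<^sub>M tuple_space n)"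
    by measurable
  from measurable_compose[OF this measurable_translate] show ?thesis by (simp add: case_prod_beta')
qed

text \<open>
  For each \<open>\<omega>\<close>, substitute \<open>y - \<xi> (t 1) \<omega>\<close> for \<open>y\<close> in the integral over the starting point. Lebesgue measure
  does not change, and the factor \<open>exp (l \<bullet> \<xi> (t 1) \<omega>)\<close> that comes out of the density is the tilt. The first
  coordinate of a tuple is now \<open>y\<close> itself.
\<close>

lemma particle_intensity_exp_measure:
  "particle_intensity (exp_measure l) P \<xi> n t =
     distr (exp_measure l \<Otimes>\<^sub>M tilted (t 1)) (tuple_space n) (\<lambda>(y, \<omega>). translate n y (increments n t \<omega>))"
proof (rule measure_eqI)
  interpret L: pair_sigma_finite lborel P ..
  interpret T: finite_measure "tilted (t 1)" by (rule finite_measure_tilted)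
  define a where "a y \<omega> = (\<lambda>j\<in>{1..n}. y + \<xi> (t j) \<omega>)" for y \<omega>
  have am: "(\<lambda>(y, \<omega>). a y \<omega>) \<in> measurable (borel \<Otimes>\<^sub>M P) (tuple_space n)"
    unfolding a_def by measurable
  then have am'[measurable]: "(\<lambda>q. a (fst q) (snd q)) \<in> measurable (borel \<Otimes>\<^sub>M P) (tuple_space n)"
    by (simp add: case_prod_beta')
  have tm[measurable]: "(\<lambda>q. translate n (fst q) (increments n t (snd q))) \<in> measurable (borel \<Otimes>\<^sub>M P) (tuple_space n)"
    using measurable_translate_increments by (simp add: case_prod_beta')
  show "sets (particle_intensity (exp_measure l) P \<xi> n t) =
      sets (distr (exp_measure l \<Otimes>\<^sub>M tilted (t 1)) (tuple_space n) (\<lambda>(y, \<omega>). translate n y (increments n t \<omega>)))"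
    by (simp add: particle_intensity_def)
  fix B assume "B \<in> sets (particle_intensity (exp_measure l) P \<xi> n t)"
  then have B[measurable]: "B \<in> sets (tuple_space n)" by (simp add: particle_intensity_def)
  have bm: "(\<lambda>q. indicator B (a (fst q) (snd q)) :: ennreal) \<in> borel_measurable (borel \<Otimes>\<^sub>M P)"
    by measurable
  have bm2: "(\<lambda>q. indicator B (translate n (fst q) (increments n t (snd q))) :: ennreal) \<in> borel_measurable (borel \<Otimes>\<^sub>M P)"
    by measurable
  have bm_slice: "(\<lambda>\<omega>. indicator B (a y \<omega>) :: ennreal) \<in> borel_measurable P"
    "(\<lambda>\<omega>. indicator B (translate n y (increments n t \<omega>)) :: ennreal) \<in> borel_measurable P" for y
    using measurable_compose[OF measurable_Pair1' bm, of y] measurable_compose[OF measurable_Pair1' bm2, of y] by simp_all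
  have shift: "(\<integral>\<^sup>+y. ennreal (exp (- (l \<bullet> y))) * indicator B (a y \<omega>) \<partial>lborel) =
      (\<integral>\<^sup>+y. ennreal (exp (- (l \<bullet> y))) * (ennreal (exp (l \<bullet> \<xi> (t 1) \<omega>)) * indicator B (translate n y (increments n t \<omega>))) \<partial>lborel)"
    if \<omega>: "\<omega> \<in> space P" for \<omega>
  proof -
    have [measurable]: "(\<lambda>y. a y \<omega>) \<in> measurable borel (tuple_space n)" unfolding a_def by measurable
    have "(\<integral>\<^sup>+y. ennreal (exp (- (l \<bullet> y))) * indicator B (a y \<omega>) \<partial>lborel)
        = (\<integral>\<^sup>+y. ennreal (exp (- (l \<bullet> y))) * indicator B (a y \<omega>) \<partial>distr lborel borel ((+) (- \<xi> (t 1) \<omega>)))"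
      by (simp only: lborel_distr_plus)
    also have "\<dots> = (\<integral>\<^sup>+y. ennreal (exp (- (l \<bullet> (- \<xi> (t 1) \<omega> + y)))) * indicator B (a (- \<xi> (t 1) \<omega> + y) \<omega>) \<partial>lborel)"
      by (intro nn_integral_distr) measurable
    also have "\<dots> = (\<integral>\<^sup>+y. ennreal (exp (- (l \<bullet> y))) * (ennreal (exp (l \<bullet> \<xi> (t 1) \<omega>)) * indicator B (translate n y (increments n t \<omega>))) \<partial>lborel)"
    proof (intro nn_integral_cong)
      fix y
      have "a (- \<xi> (t 1) \<omega> + y) \<omega> = translate n y (increments n t \<omega>)"
        by (auto simp: a_def translate_def increments_def fun_eq_iff)
      moreover have "exp (- (l \<bullet> (- \<xi> (t 1) \<omega> + y))) = exp (- (l \<bullet> y)) * exp (l \<bullet> \<xi> (t 1) \<omega>)"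
        by (simp add: inner_add_right inner_diff_right mult_exp_exp)
      ultimately show "ennreal (exp (- (l \<bullet> (- \<xi> (t 1) \<omega> + y)))) * indicator B (a (- \<xi> (t 1) \<omega> + y) \<omega>)
         = ennreal (exp (- (l \<bullet> y))) * (ennreal (exp (l \<bullet> \<xi> (t 1) \<omega>)) * indicator B (translate n y (increments n t \<omega>)))"
        by (simp add: ennreal_mult mult.assoc)
    qed
    finally show ?thesis .
  qed
  have "emeasure (particle_intensity (exp_measure l) P \<xi> n t) B =
      (\<integral>\<^sup>+z. indicator B z \<partial>particle_intensity (exp_measure l) P \<xi> n t)"
    using B unfolding particle_intensity_def by (intro nn_integral_indicator[symmetric]) simp
  also have "\<dots> = (\<integral>\<^sup>+q. indicator B (a (fst q) (snd q)) \<partial>(exp_measure l \<Otimes>\<^sub>M P))"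
    unfolding particle_intensity_def a_def[symmetric]
    by (subst nn_integral_distr) (use am B in \<open>auto simp: case_prod_beta' simp del: One_nat_def cong: measurable_cong_sets sets_pair_measure_cong\<close>)
  also have "\<dots> = (\<integral>\<^sup>+y. \<integral>\<^sup>+\<omega>. indicator B (a y \<omega>) \<partial>P \<partial>exp_measure l)"
    using bm by (subst nn_integral_fst[symmetric]) (auto cong: measurable_cong_sets sets_pair_measure_cong)
  also have "\<dots> = (\<integral>\<^sup>+y. \<integral>\<^sup>+\<omega>. ennreal (exp (- (l \<bullet> y))) * indicator B (a y \<omega>) \<partial>P \<partial>lborel)"
    unfolding exp_measure_def
    by (subst nn_integral_density) (auto simp: nn_integral_cmult bm_slice)
  also have "\<dots> = (\<integral>\<^sup>+\<omega>. \<integral>\<^sup>+y. ennreal (exp (- (l \<bullet> y))) * indicator B (a y \<omega>) \<partial>lborel \<partial>P)"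
    by (rule L.Fubini'[symmetric]) measurable
  also have "\<dots> = (\<integral>\<^sup>+\<omega>. \<integral>\<^sup>+y. ennreal (exp (- (l \<bullet> y))) * (ennreal (exp (l \<bullet> \<xi> (t 1) \<omega>)) * indicator B (translate n y (increments n t \<omega>))) \<partial>lborel \<partial>P)"
    by (intro nn_integral_cong shift)
  also have "\<dots> = (\<integral>\<^sup>+y. \<integral>\<^sup>+\<omega>. ennreal (exp (- (l \<bullet> y))) * (ennreal (exp (l \<bullet> \<xi> (t 1) \<omega>)) * indicator B (translate n y (increments n t \<omega>))) \<partial>P \<partial>lborel)"
    by (rule L.Fubini') measurable
  also have "\<dots> = (\<integral>\<^sup>+y. \<integral>\<^sup>+\<omega>. indicator B (translate n y (increments n t \<omega>)) \<partial>tilted (t 1) \<partial>exp_measure l)"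
    unfolding exp_measure_def tilted_def
    by (subst nn_integral_density) (auto simp: nn_integral_cmult nn_integral_density bm_slice)
  also have "\<dots> = (\<integral>\<^sup>+q. indicator B (translate n (fst q) (increments n t (snd q))) \<partial>(exp_measure l \<Otimes>\<^sub>M tilted (t 1)))"
    using bm2 by (subst T.nn_integral_fst[symmetric]) (auto cong: measurable_cong_sets sets_pair_measure_cong)
  also have "\<dots> = emeasure (distr (exp_measure l \<Otimes>\<^sub>M tilted (t 1)) (tuple_space n) (\<lambda>(y, \<omega>). translate n y (increments n t \<omega>))) B"
  proof -
    have "(\<lambda>(y, \<omega>). translate n y (increments n t \<omega>)) \<in> measurable (exp_measure l \<Otimes>\<^sub>M tilted (t 1)) (tuple_space n)"
      using measurable_translate_increments[of n t] by (simp cong: measurable_cong_sets sets_pair_measure_cong)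
    from nn_integral_distr[OF this, of "indicator B"] show ?thesis
      using B by (simp add: case_prod_beta' del: One_nat_def)
  qed
  finally show "emeasure (particle_intensity (exp_measure l) P \<xi> n t) B
     = emeasure (distr (exp_measure l \<Otimes>\<^sub>M tilted (t 1)) (tuple_space n) (\<lambda>(y, \<omega>). translate n y (increments n t \<omega>))) B" .
qed

lemma char_fun_eq_integral_tilted:
  assumes "n \<ge> 1"
  shows "char_fun P \<xi> n t (tilt l u) = (\<integral>\<omega>. iexp (\<Sum>j=1..n. u j \<bullet> \<xi> (t j) \<omega>) \<partial>tilted (t 1))"
  unfolding char_fun_tilt[OF assms] tilted_def
  by (subst integral_density) (auto simp: scaleR_conv_of_real)

text \<open>
  A frequency for the increments is a frequency for the values with sum zero: the opposite of the total is
  charged to the first time.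
\<close>

lemma sum_inner_increments:
  fixes u :: "nat \<Rightarrow> real ^ 'd"
  assumes "n \<ge> 1"
  shows "(\<Sum>j=1..n. u j \<bullet> increments n t \<omega> j)
    = (\<Sum>j=1..n. (u j - (if j = 1 then \<Sum>i=1..n. u i else 0)) \<bullet> \<xi> (t j) \<omega>)"
proof -
  have "(\<Sum>j=1..n. u j \<bullet> increments n t \<omega> j) = (\<Sum>j=1..n. u j \<bullet> \<xi> (t j) \<omega>) - (\<Sum>j=1..n. u j) \<bullet> \<xi> (t 1) \<omega>"
    by (simp add: increments_def inner_diff_right sum_subtractf inner_sum_left)
  also have "(\<Sum>j=1..n. u j) \<bullet> \<xi> (t 1) \<omega> = (\<Sum>j=1..n. (if j = 1 then \<Sum>i=1..n. u i else 0) \<bullet> \<xi> (t j) \<omega>)"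
  proof -
    have "(\<Sum>j=1..n. (if j = 1 then \<Sum>i=1..n. u i else 0) \<bullet> \<xi> (t j) \<omega>)
        = (\<Sum>j=1..n. if j = 1 then (\<Sum>i=1..n. u i) \<bullet> \<xi> (t 1) \<omega> else 0)"
      by (intro sum.cong) auto
    then show ?thesis using assms by (simp add: sum.delta)
  qed
  finally show ?thesis by (simp add: inner_diff_left sum_subtractf)
qed

text \<open>
  The whole wave would not be integrable, as the intensity is infinite. Cutting off the first coordinate, which is
  independent of the increments, makes it so and costs only the factor \<open>measure (exp_measure l) (ball 0 1)\<close>.
\<close>

lemma integral_particle_intensity_wave:
  fixes u :: "nat \<Rightarrow> real ^ 'd"
  assumes n: "n \<ge> 1" and u: "(\<Sum>i=1..n. u i) = 0"
  shows "(\<integral>z. indicator (ball 0 1) (z 1) * iexp (\<Sum>j=1..n. u j \<bullet> z j) \<partial>particle_intensity (exp_measure l) P \<xi> n t)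
       = of_real (measure (exp_measure l) (ball 0 1)) * char_fun P \<xi> n t (tilt l u)"
proof -
  let ?K = "ball (0 :: real ^ 'd) 1"
  interpret T: finite_measure "tilted (t 1)" by (rule finite_measure_tilted)
  interpret L: sigma_finite_measure "exp_measure l" by (rule sigma_finite_exp_measure)
  interpret D: pair_sigma_finite "exp_measure l" "tilted (t 1)" ..
  define W where "W \<omega> = iexp (\<Sum>j=1..n. u j \<bullet> \<xi> (t j) \<omega>)" for \<omega>
  have [measurable]: "W \<in> borel_measurable P" unfolding W_def by measurable
  have W: "norm (W \<omega>) = 1" for \<omega> unfolding W_def by simp
  have wave: "(\<lambda>z. indicator ?K (z 1) * iexp (\<Sum>j=1..n. u j \<bullet> z j)) \<in> borel_measurable (tuple_space n)"
  proof -
    have "(\<lambda>z. z 1) \<in> borel_measurable (tuple_space n)" using n by (intro measurable_component_singleton) auto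
    moreover have "(\<lambda>z. \<Sum>j=1..n. u j \<bullet> z j) \<in> borel_measurable (tuple_space n)"
      by (intro borel_measurable_sum borel_measurable_inner measurable_component_singleton) auto
    moreover from this have "(\<lambda>z. iexp (\<Sum>j=1..n. u j \<bullet> z j)) \<in> borel_measurable (tuple_space n)"
      by (rule measurable_compose) measurable
    moreover have "(\<lambda>v. indicator ?K v :: complex) \<in> borel_measurable borel"
      by (intro borel_measurable_indicator) simp
    ultimately show ?thesis
      by (intro borel_measurable_times) (auto intro: measurable_compose)
  qed
  have shift_invariant: "iexp (\<Sum>j=1..n. u j \<bullet> translate n y (increments n t \<omega>) j) = W \<omega>" for y \<omega>
  proof -
    have "(\<Sum>j=1..n. u j \<bullet> translate n y (increments n t \<omega>) j) = (\<Sum>j=1..n. u j) \<bullet> y + (\<Sum>j=1..n. u j \<bullet> increments n t \<omega> j)"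
      by (simp add: translate_def inner_add_right sum.distrib inner_sum_left)
    also have "\<dots> = (\<Sum>j=1..n. u j \<bullet> \<xi> (t j) \<omega>)"
      unfolding sum_inner_increments[OF n] u by simp
    finally show ?thesis by (simp add: W_def)
  qed
  have first: "translate n y (increments n t \<omega>) 1 = y" for y \<omega>
    using n by (simp add: translate_def increments_def)
  have integrable_K: "integrable (exp_measure l) (\<lambda>y. indicator ?K y :: real)"
    using emeasure_exp_measure_ball(2)[of l] by (intro integrable_real_indicator) auto
  have "(\<integral>z. indicator ?K (z 1) * iexp (\<Sum>j=1..n. u j \<bullet> z j) \<partial>particle_intensity (exp_measure l) P \<xi> n t)
      = (\<integral>q. indicator ?K (fst q) * W (snd q) \<partial>(exp_measure l \<Otimes>\<^sub>M tilted (t 1)))"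
    unfolding particle_intensity_exp_measure
    using measurable_translate_increments[of n t] wave shift_invariant first
    by (subst integral_distr)
      (auto simp: case_prod_beta' cong: measurable_cong_sets sets_pair_measure_cong)
  also have "\<dots> = (\<integral>y. \<integral>\<omega>. indicator ?K y * W \<omega> \<partial>tilted (t 1) \<partial>exp_measure l)"
  proof (subst D.integral_fst'[symmetric])
    show "integrable (exp_measure l \<Otimes>\<^sub>M tilted (t 1)) (\<lambda>q. indicator ?K (fst q) * W (snd q))"
    proof (rule D.Fubini_integrable)
      have "(\<integral>\<omega>. norm (indicator ?K y * W \<omega>) \<partial>tilted (t 1)) = indicator ?K y * measure (tilted (t 1)) (space P)" for y
        by (simp add: norm_mult W indicator_def)
      then show "integrable (exp_measure l) (\<lambda>y. \<integral>\<omega>. norm (indicator ?K (fst (y, \<omega>)) * W (snd (y, \<omega>))) \<partial>tilted (t 1))"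
        using integrable_K by simp
      show "AE y in exp_measure l. integrable (tilted (t 1)) (\<lambda>\<omega>. indicator ?K (fst (y, \<omega>)) * W (snd (y, \<omega>)))"
        by (intro AE_I2 T.integrable_const_bound[where B=1]) (auto simp: W norm_mult indicator_def)
      show "(\<lambda>q. indicator ?K (fst q) * W (snd q)) \<in> borel_measurable (exp_measure l \<Otimes>\<^sub>M tilted (t 1))"
      proof (intro borel_measurable_times)
        show "(\<lambda>q. indicator ?K (fst q)) \<in> borel_measurable (exp_measure l \<Otimes>\<^sub>M tilted (t 1))"
          by (rule measurable_compose[OF measurable_fst]) (simp add: borel_measurable_indicator)
        show "(\<lambda>q. W (snd q)) \<in> borel_measurable (exp_measure l \<Otimes>\<^sub>M tilted (t 1))"
          by (rule measurable_compose[OF measurable_snd]) measurable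
      qed
    qed
  qed simp
  also have "\<dots> = (\<integral>y. of_real (indicator ?K y) * (\<integral>\<omega>. W \<omega> \<partial>tilted (t 1)) \<partial>exp_measure l)"
    by (simp add: of_real_indicator)
  also have "\<dots> = of_real (measure (exp_measure l) ?K) * (\<integral>\<omega>. W \<omega> \<partial>tilted (t 1))"
    using integrable_K by (subst integral_mult_left_zero) auto
  also have "(\<integral>\<omega>. W \<omega> \<partial>tilted (t 1)) = char_fun P \<xi> n t (tilt l u)"
    unfolding char_fun_eq_integral_tilted[OF n] W_def ..
  finally show ?thesis .
qed

text \<open>
  Fourier uniqueness for the increments: all frequencies occur, because \<open>u\<^sub>1\<close> is fixed by the sum condition while
  the first increment is always zero.
\<close>

lemma tilted_increments_law_eq:
  fixes t t' :: "nat \<Rightarrow> real"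
  assumes n: "n \<ge> 1" and A: "A \<in> sets (tuple_space n)"
    and char: "\<And>u. (\<Sum>i=1..n. u i) = 0 \<Longrightarrow> char_fun P \<xi> n t (tilt l u) = char_fun P \<xi> n t' (tilt l u)"
  shows "emeasure (tilted (t 1)) (increments n t -` A \<inter> space P)
       = emeasure (tilted (t' 1)) (increments n t' -` A \<inter> space P)"
proof -
  let ?w = "\<lambda>t \<omega>. exp (l \<bullet> \<xi> (t (1::nat)) \<omega>)"
  let ?E = "range (\<lambda>u v. iexp ((u :: real ^ 'd) \<bullet> v))"
  let ?T = "{\<lambda>p. \<Prod>j\<in>{1..n}. \<phi> j (p j) |\<phi>. \<forall>j\<in>{1..n}. \<phi> j \<in> ?E}"
  have E: "\<phi> \<in> borel_measurable borel" "norm (\<phi> y) \<le> 1" if "\<phi> \<in> ?E" for \<phi> y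
    using that by auto
  have det: "determining (count_space (UNIV :: bool set) \<Otimes>\<^sub>M P) (tuple_space n) ?T"
    by (rule determining_PiM[OF finite_atLeastAtMost determining_exp_vec]) (fact E)+
  have integrable_w: "integrable P (?w t)" for t
    using exponential_moment[of "t 1"] by (intro integrableI_nonneg) auto
  have "(\<integral>\<omega>. indicator A (increments n t \<omega>) * complex_of_real (?w t \<omega>) \<partial>P)
      = (\<integral>\<omega>. indicator A (increments n t' \<omega>) * complex_of_real (?w t' \<omega>) \<partial>P)"
  proof (rule determining_two_laws[OF _ det])
    show "sigma_finite_measure P" by unfold_locales
    fix \<psi> assume "\<psi> \<in> ?T"
    then obtain \<phi> where \<psi>: "\<psi> = (\<lambda>p. \<Prod>j\<in>{1..n}. \<phi> j (p j))" and \<phi>: "\<forall>j\<in>{1..n}. \<phi> j \<in> ?E" by blast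
    show "\<psi> \<in> borel_measurable (tuple_space n)"
      unfolding \<psi> using E(1) \<phi>
      by (intro borel_measurable_prod measurable_compose[OF measurable_component_singleton]) auto
    show "norm (\<psi> y) \<le> 1" for y
      unfolding \<psi> using E(2) \<phi> by (auto simp: prod_norm[symmetric] intro!: prod_le_1)
    have "\<forall>j\<in>{1..n}. \<exists>u. \<phi> j = (\<lambda>v. iexp (u \<bullet> v))" using \<phi> by auto
    then obtain u where "\<And>j. j \<in> {1..n} \<Longrightarrow> \<phi> j = (\<lambda>v. iexp (u j \<bullet> v))" by metis
    then have \<psi>u: "\<psi> p = iexp (\<Sum>j=1..n. u j \<bullet> p j)" for p
      by (simp add: \<psi> sum_distrib_left exp_sum)
    \<comment> \<open>The frequency \<open>v\<close> has sum zero and acts on the values as \<open>u\<close> does on the increments.\<close>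
    define v where "v j = u j - (if j = 1 then \<Sum>i=1..n. u i else 0)" for j
    have "(\<Sum>j=1..n. v j) = 0" using n by (simp add: v_def sum_subtractf sum.delta)
    moreover have "(\<integral>\<omega>. \<psi> (increments n t \<omega>) * complex_of_real (?w t \<omega>) \<partial>P) = char_fun P \<xi> n t (tilt l v)" for t
      unfolding char_fun_tilt[OF n] \<psi>u sum_inner_increments[OF n] v_def
      by (intro Bochner_Integration.integral_cong) (auto simp: mult.commute)
    ultimately show "(\<integral>\<omega>. \<psi> (increments n t \<omega>) * complex_of_real (?w t \<omega>) \<partial>P)
        = (\<integral>\<omega>. \<psi> (increments n t' \<omega>) * complex_of_real (?w t' \<omega>) \<partial>P)"
      using char by simp
  qed (use integrable_w in \<open>auto intro!: integrable_of_real measurable_increments A simp del: One_nat_def\<close>)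
  moreover have "emeasure (tilted (t 1)) (increments n t -` A \<inter> space P)
      = ennreal (Re (\<integral>\<omega>. indicator A (increments n t \<omega>) * complex_of_real (?w t \<omega>) \<partial>P))" for t
  proof -
    have [measurable]: "increments n t -` A \<inter> space P \<in> sets P" using A by (rule measurable_sets[OF measurable_increments])
    have "emeasure (tilted (t 1)) (increments n t -` A \<inter> space P)
        = (\<integral>\<^sup>+\<omega>. ennreal (indicator (increments n t -` A \<inter> space P) \<omega> * ?w t \<omega>) \<partial>P)"
      unfolding tilted_def by (subst emeasure_density) (auto intro!: nn_integral_cong simp: indicator_def)
    also have "\<dots> = ennreal (\<integral>\<omega>. indicator (increments n t -` A \<inter> space P) \<omega> * ?w t \<omega> \<partial>P)"
      using integrable_mult_indicator[OF _ integrable_w[of t], of "increments n t -` A \<inter> space P"]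
      by (intro nn_integral_eq_integral) auto
    also have "(\<integral>\<omega>. indicator (increments n t -` A \<inter> space P) \<omega> * ?w t \<omega> \<partial>P)
        = Re (\<integral>\<omega>. complex_of_real (indicator (increments n t -` A \<inter> space P) \<omega> * ?w t \<omega>) \<partial>P)"
      by (simp only: integral_complex_of_real Re_complex_of_real)
    also have "(\<integral>\<omega>. complex_of_real (indicator (increments n t -` A \<inter> space P) \<omega> * ?w t \<omega>) \<partial>P)
        = (\<integral>\<omega>. indicator A (increments n t \<omega>) * complex_of_real (?w t \<omega>) \<partial>P)"
      by (intro Bochner_Integration.integral_cong) (auto simp: indicator_def)
    finally show ?thesis .
  qed
  ultimately show ?thesis by simp
qed

theorem particle_intensity_eq_iff_char_fun_eq:
  fixes t t' :: "nat \<Rightarrow> real"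
  assumes n: "n \<ge> 1"
  shows "particle_intensity (exp_measure l) P \<xi> n t = particle_intensity (exp_measure l) P \<xi> n t' \<longleftrightarrow>
    (\<forall>u. (\<Sum>i=1..n. u i) = 0 \<longrightarrow> char_fun P \<xi> n t (tilt l u) = char_fun P \<xi> n t' (tilt l u))"
    (is "?I t = ?I t' \<longleftrightarrow> ?C")
proof
  assume I: "?I t = ?I t'"
  have "measure (exp_measure l) (ball 0 1) \<noteq> 0"
    using emeasure_exp_measure_ball[of l] by (auto simp: measure_def enn2real_eq_0_iff)
  then show ?C
    using integral_particle_intensity_wave[OF n, of _ t] integral_particle_intensity_wave[OF n, of _ t'] I
    by auto
next
  assume C: ?C
  show "?I t = ?I t'"
  proof (rule measure_eqI)
    show "sets (?I t) = sets (?I t')" by (simp add: particle_intensity_def)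
    fix B assume "B \<in> sets (?I t)"
    then have B[measurable]: "B \<in> sets (tuple_space n)" by (simp add: particle_intensity_def)
    have slice: "emeasure (?I t) B
        = (\<integral>\<^sup>+y. emeasure (tilted (t 1)) (increments n t -` (translate n y -` B \<inter> space (tuple_space n)) \<inter> space P) \<partial>exp_measure l)" for t
    proof -
      interpret T: finite_measure "tilted (t 1)" by (rule finite_measure_tilted)
      let ?m = "\<lambda>(y, \<omega>). translate n y (increments n t \<omega>)"
      have m: "?m \<in> measurable (exp_measure l \<Otimes>\<^sub>M tilted (t 1)) (tuple_space n)"
        using measurable_translate_increments[of n t] by (simp cong: measurable_cong_sets sets_pair_measure_cong)
      have "emeasure (?I t) B = emeasure (exp_measure l \<Otimes>\<^sub>M tilted (t 1)) (?m -` B \<inter> space (exp_measure l \<Otimes>\<^sub>M tilted (t 1)))"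
        unfolding particle_intensity_exp_measure by (rule emeasure_distr[OF m B])
      also have "\<dots> = (\<integral>\<^sup>+y. emeasure (tilted (t 1)) (Pair y -` (?m -` B \<inter> space (exp_measure l \<Otimes>\<^sub>M tilted (t 1)))) \<partial>exp_measure l)"
        by (rule T.emeasure_pair_measure_alt[OF measurable_sets[OF m B]])
      also have "\<dots> = (\<integral>\<^sup>+y. emeasure (tilted (t 1)) (increments n t -` (translate n y -` B \<inter> space (tuple_space n)) \<inter> space P) \<partial>exp_measure l)"
        using measurable_space[OF measurable_increments, of _ n t]
        by (intro nn_integral_cong arg_cong[where f="emeasure (tilted (t 1))"]) (auto simp: space_pair_measure)
      finally show ?thesis .
    qed
    have "translate n y \<in> measurable (tuple_space n) (tuple_space n)" for y
      unfolding translate_def by measurable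
    then have "translate n y -` B \<inter> space (tuple_space n) \<in> sets (tuple_space n)" for y
      using B by (rule measurable_sets)
    then show "emeasure (?I t) B = emeasure (?I t') B"
      unfolding slice using C by (intro nn_integral_cong tilted_increments_law_eq[OF n]) auto
  qed
qed

end

theorem theorem4p1:
  fixes l :: "real ^ 'd"
    and P :: "'p measure"
    and \<xi> :: "real \<Rightarrow> 'p \<Rightarrow> real ^ 'd"
    and M :: "'w measure"
    and x :: "nat \<Rightarrow> 'w \<Rightarrow> real ^ 'd"
    and \<Xi> :: "nat \<Rightarrow> real \<Rightarrow> 'w \<Rightarrow> real ^ 'd"
  assumes "prob_space P"
    and "\<And>t. \<xi> t \<in> borel_measurable P"
    and "\<And>t. (\<integral>\<^sup>+\<omega>. ennreal (exp (l \<bullet> \<xi> t \<omega>)) \<partial>P) < \<infinity>"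
    and "particle_system M (exp_measure l) P \<xi> x \<Xi>"
  shows "stationary_particles M x \<Xi> \<longleftrightarrow>
    (\<forall>n\<ge>1. \<forall>(s::real) (t :: nat \<Rightarrow> real) (u :: nat \<Rightarrow> real ^ 'd). (\<Sum>i=1..n. u i) = 0 \<longrightarrow>
       char_fun P \<xi> n t (tilt l u) = char_fun P \<xi> n (\<lambda>i. t i + s) (tilt l u))"
proof -
  interpret exponential_moment_process P l \<xi>
    using assms by (auto simp: exponential_moment_process_def exponential_moment_process_axioms_def)
  interpret particles: particle_system M "exp_measure l" P \<xi> x \<Xi> by fact
  show ?thesis
    unfolding stationary_particles_def particles.particles_law_eq_iff_intensity_eq[OF assms(1,2)]
    using particle_intensity_eq_iff_char_fun_eq by blast
qed

end
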